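(* For any $n\in\mathbb{N}$, $\boldsymbol{\mathcal{V}}(\mathsf{plac}_n)$ does not contain $\mathsf{styl}_d$, where $d=2\left(2^{\lfloor n^2/4\rfloor}+\lfloor n^2/4\rfloor\right)$.
   Context: $\mathbb{N}=\{1,2,3,\dots\}$, and for $n\in\mathbb{N}$ let $\mathcal{A}_n=\{1<2<\cdots<n\}$. The plactic monoid of rank $n$, $\mathsf{plac}_n$, is the monoid presented by generators $\mathcal{A}_n$ and the Knuth relations $acb=cab$ (for $a\le b<c$) and $bac=bca$ (for $a<b\le c$), $a,b,c\in\mathcal{A}_n$. The stylic monoid of rank $n$, $\mathsf{styl}_n$, is the monoid presented by generators $\mathcal{A}_n$, the same Knuth relations, and the relations $a^2=a$ for $a\in\mathcal{A}_n$. A variety is a class of monoids closed under homomorphic images, submonoids and direct products; $\boldsymbol{\mathcal{V}}(M)$ is the variety generated by the monoid $M$. *)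

theory Defs
  imports "HOL-Algebra.Product_Groups"
begin

section \<open>Monoid presentations\<close>

text \<open>The least congruence on the free monoid \<^term>\<open>lists X\<close> that contains \<open>R\<close>; it is meant
  for \<^prop>\<open>R \<subseteq> lists X \<times> lists X\<close>.\<close>

inductive_set pres_cong :: "'a set \<Rightarrow> ('a list \<times> 'a list) set \<Rightarrow> ('a list \<times> 'a list) set"
  for X :: "'a set" and R :: "('a list \<times> 'a list) set" where
  base: "(u, v) \<in> R \<Longrightarrow> (u, v) \<in> pres_cong X R"
| refl: "u \<in> lists X \<Longrightarrow> (u, u) \<in> pres_cong X R"
| sym: "(u, v) \<in> pres_cong X R \<Longrightarrow> (v, u) \<in> pres_cong X R"
| trans: "(u, v) \<in> pres_cong X R \<Longrightarrow> (v, w) \<in> pres_cong X R \<Longrightarrow> (u, w) \<in> pres_cong X R"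
| append: "(u, v) \<in> pres_cong X R \<Longrightarrow> (u', v') \<in> pres_cong X R
    \<Longrightarrow> (u @ u', v @ v') \<in> pres_cong X R"

definition presented_monoid :: "'a set \<Rightarrow> ('a list \<times> 'a list) set \<Rightarrow> 'a list set monoid" where
  "presented_monoid X R =
    \<lparr>carrier = lists X // pres_cong X R,
     monoid.mult = (\<lambda>A B. \<Union>u\<in>A. \<Union>v\<in>B. pres_cong X R `` {u @ v}),
     one = pres_cong X R `` {[]}\<rparr>"

lemma pres_cong_lists:
  assumes "R \<subseteq> lists X \<times> lists X" "(u, v) \<in> pres_cong X R"
  shows "u \<in> lists X \<and> v \<in> lists X"
  using assms(2,1) by (induction rule: pres_cong.induct) auto

lemma equiv_pres_cong:
  assumes "R \<subseteq> lists X \<times> lists X"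
  shows "equiv (lists X) (pres_cong X R)"
proof (rule equivI)
  show "pres_cong X R \<subseteq> lists X \<times> lists X"
    using pres_cong_lists[OF assms] by (intro subrelI SigmaI) simp_all
  show "refl_on (lists X) (pres_cong X R)"
    by (rule refl_onI) (rule pres_cong.refl)
  show "sym (pres_cong X R)"
    by (rule symI) (rule pres_cong.sym)
  show "trans (pres_cong X R)"
    by (rule transI) (rule pres_cong.trans)
qed

lemma presented_monoid_mult:
  assumes "R \<subseteq> lists X \<times> lists X" "u \<in> lists X" "v \<in> lists X"
  shows "(pres_cong X R `` {u}) \<otimes>\<^bsub>presented_monoid X R\<^esub> (pres_cong X R `` {v})
    = pres_cong X R `` {u @ v}"
proof -
  note eq = equiv_pres_cong[OF assms(1)]
  have "pres_cong X R `` {a @ b} = pres_cong X R `` {u @ v}"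
    if "(u, a) \<in> pres_cong X R" "(v, b) \<in> pres_cong X R" for a b
    using equiv_class_eq[OF eq pres_cong.append[OF that]] by simp
  then have "(\<Union>a\<in>pres_cong X R `` {u}. \<Union>b\<in>pres_cong X R `` {v}. pres_cong X R `` {a @ b})
    = (\<Union>a\<in>pres_cong X R `` {u}. \<Union>b\<in>pres_cong X R `` {v}. pres_cong X R `` {u @ v})"
    by (intro SUP_cong HOL.refl) simp_all
  moreover have "u \<in> pres_cong X R `` {u}" "v \<in> pres_cong X R `` {v}"
    using assms by (simp_all only: Image_singleton_iff pres_cong.refl)
  then have "pres_cong X R `` {u} \<noteq> {}" "pres_cong X R `` {v} \<noteq> {}"
    by (metis empty_iff)+
  ultimately show ?thesis
    unfolding presented_monoid_def by simp
qed

lemma monoid_presented_monoid: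
  assumes "R \<subseteq> lists X \<times> lists X"
  shows "monoid (presented_monoid X R)"
proof -
  let ?M = "presented_monoid X R" and ?c = "\<lambda>u. pres_cong X R `` {u}"
  have car: "carrier ?M = ?c ` lists X"
    by (auto simp: presented_monoid_def quotient_def)
  have one: "\<one>\<^bsub>?M\<^esub> = ?c []"
    by (simp add: presented_monoid_def)
  note mult = presented_monoid_mult[OF assms]
  have app: "u @ v \<in> lists X" if "u \<in> lists X" "v \<in> lists X" for u v
    using that by simp
  have nil: "[] \<in> lists X" by simp
  show ?thesis
  proof (rule monoidI)
    show "\<one>\<^bsub>?M\<^esub> \<in> carrier ?M"
      unfolding car one using nil by (rule imageI)
    fix x assume "x \<in> carrier ?M"
    then obtain u where u: "u \<in> lists X" "x = ?c u" unfolding car by blast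
    show "\<one>\<^bsub>?M\<^esub> \<otimes>\<^bsub>?M\<^esub> x = x" "x \<otimes>\<^bsub>?M\<^esub> \<one>\<^bsub>?M\<^esub> = x"
      unfolding one u(2) mult[OF nil u(1)] mult[OF u(1) nil] by simp_all
    fix y assume "y \<in> carrier ?M"
    then obtain v where v: "v \<in> lists X" "y = ?c v" unfolding car by blast
    show "x \<otimes>\<^bsub>?M\<^esub> y \<in> carrier ?M"
      unfolding car u(2) v(2) mult[OF u(1) v(1)] using app[OF u(1) v(1)] by (rule imageI)
    fix z assume "z \<in> carrier ?M"
    then obtain w where w: "w \<in> lists X" "z = ?c w" unfolding car by blast
    show "x \<otimes>\<^bsub>?M\<^esub> y \<otimes>\<^bsub>?M\<^esub> z = x \<otimes>\<^bsub>?M\<^esub> (y \<otimes>\<^bsub>?M\<^esub> z)"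
      unfolding u(2) v(2) w(2) mult[OF u(1) v(1)] mult[OF v(1) w(1)]
        mult[OF app[OF u(1) v(1)] w(1)] mult[OF u(1) app[OF v(1) w(1)]]
      by simp
  qed
qed


section \<open>Plactic and stylic monoids\<close>

definition knuth_rels :: "nat \<Rightarrow> (nat list \<times> nat list) set" where
  "knuth_rels n =
     {([a, c, b], [c, a, b]) | a b c. {a, b, c} \<subseteq> {1..n} \<and> a \<le> b \<and> b < c}
   \<union> {([b, a, c], [b, c, a]) | a b c. {a, b, c} \<subseteq> {1..n} \<and> a < b \<and> b \<le> c}"

definition plac :: "nat \<Rightarrow> nat list set monoid" where
  "plac n = presented_monoid {1..n} (knuth_rels n)"

definition styl :: "nat \<Rightarrow> nat list set monoid" where
  "styl n = presented_monoid {1..n} (knuth_rels n \<union> {([a, a], [a]) | a. a \<in> {1..n}})"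

lemma monoid_plac: "monoid (plac n)"
  unfolding plac_def by (rule monoid_presented_monoid) (auto simp: knuth_rels_def)

lemma monoid_styl: "monoid (styl n)"
  unfolding styl_def by (rule monoid_presented_monoid) (auto simp: knuth_rels_def)


section \<open>Varieties of monoids\<close>

text \<open>Classes of monoids are represented by sets of monoids whose carriers lie in a type \<open>'u\<close>, which
  plays the role of a universe and is left arbitrary.  A direct product of members does not literally
  have its carrier in \<open>'u\<close>, so closure under products refers to the monoids over \<open>'u\<close> that are
  isomorphic to such a product.  Taking index sets in \<open>'u\<close> is no restriction: a product with \<open>J\<close>
  many nontrivial factors has at least \<open>2^|J|\<close> elements, so if it has a copy over \<open>'u\<close>, then \<open>J\<close>
  embeds into \<open>'u\<close>, and trivial factors can be omitted.  The library's \<^const>\<open>product_group\<close> is the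
  componentwise product and makes sense for monoids.\<close>

definition monoid_variety :: "'u monoid set \<Rightarrow> bool" where
  "monoid_variety K \<longleftrightarrow>
     (\<forall>M\<in>K. monoid M) \<and>
     (\<forall>M\<in>K. \<forall>N. monoid N \<and> epi M N \<noteq> {} \<longrightarrow> N \<in> K) \<and>
     (\<forall>M\<in>K. \<forall>H. submonoid H M \<longrightarrow> M\<lparr>carrier := H\<rparr> \<in> K) \<and>
     (\<forall>(I :: 'u set) F N. (\<forall>i\<in>I. F i \<in> K) \<and> monoid N \<and> product_group I F \<cong> N \<longrightarrow> N \<in> K)"

text \<open>The members over \<open>'u\<close> of the variety generated by \<open>M\<close>; the carrier of \<open>M\<close> may live in a
  different type, so generation refers to its isomorphic copies over \<open>'u\<close>.  The universe has to be
  large enough to be meaningful: a finitely generated member of the variety generated by a countable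
  monoid \<open>M\<close> is a homomorphic image of a submonoid of a countable power of \<open>M\<close>, so a type of at
  least continuum cardinality suffices in that case.\<close>

definition variety_generated :: "'a monoid \<Rightarrow> 'u monoid set" where
  "variety_generated M =
     \<Inter> {K. monoid_variety K \<and> (\<forall>P. monoid P \<and> P \<cong> M \<longrightarrow> P \<in> K)}"

lemma monoid_variety_all: "monoid_variety {M :: 'u monoid. monoid M}"
  unfolding monoid_variety_def by (blast intro: submonoid.submonoid_is_monoid)

lemma monoid_variety_generated: "monoid_variety (variety_generated M :: 'u monoid set)"
proof -
  have "monoid N" if "N \<in> variety_generated M" for N :: "'u monoid"
    using that monoid_variety_all unfolding variety_generated_def by blast
  then show ?thesis
    unfolding monoid_variety_def[of "variety_generated M"]
  proof (intro conjI allI ballI impI)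
    fix L N :: "'u monoid"
    assume "L \<in> variety_generated M" "monoid N \<and> epi L N \<noteq> {}"
    then show "N \<in> variety_generated M"
      unfolding variety_generated_def monoid_variety_def by blast
  next
    fix L :: "'u monoid" and H
    assume *: "L \<in> variety_generated M" "submonoid H L"
    show "L\<lparr>carrier := H\<rparr> \<in> variety_generated M"
      unfolding variety_generated_def
    proof (rule InterI)
      fix K :: "'u monoid set"
      assume K: "K \<in> {K. monoid_variety K \<and> (\<forall>P. monoid P \<and> P \<cong> M \<longrightarrow> P \<in> K)}"
      then have "L \<in> K" using *(1) unfolding variety_generated_def by blast
      moreover have "\<forall>M\<in>K. \<forall>H. submonoid H M \<longrightarrow> M\<lparr>carrier := H\<rparr> \<in> K"
        using K unfolding monoid_variety_def mem_Collect_eq by (elim conjE)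
      ultimately have "\<forall>H. submonoid H L \<longrightarrow> L\<lparr>carrier := H\<rparr> \<in> K" by (rule bspec[rotated])
      then show "L\<lparr>carrier := H\<rparr> \<in> K" using *(2) by (elim allE[of _ H] mp)
    qed
  next
    fix I :: "'u set" and F :: "'u \<Rightarrow> 'u monoid" and N :: "'u monoid"
    assume *: "(\<forall>i\<in>I. F i \<in> variety_generated M) \<and> monoid N \<and> product_group I F \<cong> N"
    show "N \<in> variety_generated M"
      unfolding variety_generated_def
    proof (rule InterI)
      fix K :: "'u monoid set"
      assume K: "K \<in> {K. monoid_variety K \<and> (\<forall>P. monoid P \<and> P \<cong> M \<longrightarrow> P \<in> K)}"
      then have "\<forall>i\<in>I. F i \<in> K" using * unfolding variety_generated_def by blast
      with K * show "N \<in> K" unfolding monoid_variety_def by blast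
    qed
  qed
qed

lemma variety_generated_copy:
  "monoid P \<Longrightarrow> P \<cong> M \<Longrightarrow> P \<in> variety_generated M"
  by (auto simp: variety_generated_def)

end

(* Put k = floor(n^2/4) and let w be a de Bruijn word of length 2^k + k - 1 over two letters, so that
   every word of length k is a factor of w.  With X = AB and Y = BA, the identity w X w = w Y w in the
   variables A, B holds in plac_n and fails in styl_d, and identities are inherited by varieties.

   In styl_d, the set of decreasing runs j-1, ..., i+1, i that are subsequences of a word is an
   invariant.  Let c be the last and e the first letter of the word phi obtained from w by expanding
   X and Y.  The word c^|w| B A e^|w| of length d is a subsequence of phi BA phi but not of phi AB phi,
   and replacing each variable by the increasing product of the (reversed) positions at which it
   occurs in that word turns it into the full run d, ..., 2, 1.

   In plac_n, one uses the tropical representations on m-element subsets of {1..n} of Johnson and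
   Kambites: their entries are Knuth invariants, and the entries from {1..m} to {j-m+1..j} determine
   the tableau.  An entry of a product is the best weight of a chain of subsets; between the two
   subsets just named it has at most m(j-m) <= k strict steps.  Staying at a subset has the same
   weight under X and Y.  Given a chain for w X w, let R be the subset on it with the largest stay
   weight.  The strict steps before R (or those after R) use at most k letters, which occur
   consecutively in w; doing them there and staying at R across the middle factor costs nothing,
   after which X can be replaced by Y. *)

theory Submission
  imports Defs "HOL-Library.Sublist" "HOL-Library.Multiset"
begin

section \<open>De Bruijn words\<close>

lemma de_bruijn_word_exists:
  "\<exists>w :: bool list. length w = 2 ^ k + k - 1 \<and> (\<forall>s. length s = k \<longrightarrow> (\<exists>p q. w = p @ s @ q))"
proof (cases k)
  case 0
  then show ?thesis by (intro exI[of _ "[]"]) auto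
next
  case (Suc m)
  define fac where "fac w i = take k (drop i w)" for w :: "bool list" and i
  define I where "I w = {i. i + k \<le> length w}" for w :: "bool list"
  define F where "F w = fac w ` I w" for w
  define z where "z = replicate m False"
  \<comment> \<open>The invariant of Martin's greedy construction, which appends \<open>True\<close> whenever this repeats no
    factor of length \<open>k\<close>; a longest word satisfying it contains all of them.\<close>
  define good where "good w \<longleftrightarrow> take k w = replicate k False \<and> k \<le> length w \<and> inj_on (fac w) (I w) \<and>
     (\<forall>v. v @ [False] \<in> F w \<longrightarrow> v \<noteq> z \<longrightarrow> v @ [True] \<in> F w)" for w
  have I_eq: "I w = {..<Suc (length w) - k}" for w
    by (auto simp: I_def)
  have len_fac: "length s = k" if "s \<in> F w" for s w
    using that by (auto simp: F_def fac_def I_def)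
  have words: "finite {s :: bool list. length s = k}" "card {s :: bool list. length s = k} = 2 ^ k"
    using card_lists_length_eq[of "UNIV :: bool set" k] finite_lists_length_eq[of "UNIV :: bool set" k]
    by simp_all
  have cardF: "card (F w) = Suc (length w) - k" if "good w" for w
    using that by (simp add: F_def card_image good_def I_eq)
  have bound: "length w \<le> 2 ^ k + k" if "good w" for w
  proof -
    have "card (F w) \<le> 2 ^ k"
      using card_mono[OF words(1), of "F w"] len_fac words(2) by auto
    then show ?thesis using cardF[OF that] by simp
  qed
  have "good (replicate k False)"
    by (auto simp: good_def I_def F_def fac_def z_def Suc replicate_append_same[symmetric] simp del: replicate_append_same)
  then obtain w where w: "good w" and wmax: "\<And>y. good y \<Longrightarrow> length y \<le> length w"
    using ex_has_greatest_nat[of good "replicate k False" length "2 ^ k + k + 1"] bound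
    by (metis le_imp_less_Suc Suc_eq_plus1 less_or_eq_imp_le)
  have kw: "k \<le> length w" and pre: "take k w = replicate k False" and inj: "inj_on (fac w) (I w)"
    and pref: "\<And>v. v @ [False] \<in> F w \<Longrightarrow> v \<noteq> z \<Longrightarrow> v @ [True] \<in> F w"
    using w by (auto simp: good_def)
  define L where "L = length w - m"
  define e where "e = drop L w"
  have len_e: "length e = m" using kw Suc by (simp add: e_def L_def)
  have I_snoc: "I (w @ [b]) = insert L (I w)" for b
    using kw by (auto simp: I_def L_def Suc)
  have fac_snoc: "fac (w @ [b]) i = fac w i" if "i \<in> I w" for b i
    using that by (auto simp: fac_def I_def)
  have fac_L: "fac (w @ [b]) L = e @ [b]" for b
    using kw len_e by (simp add: fac_def e_def L_def Suc)
  have F_snoc: "F (w @ [b]) = insert (e @ [b]) (F w)" for b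
    using fac_snoc[of _ b] fac_L[of b] by (auto simp: F_def I_snoc image_iff)
  have L_notin: "L \<notin> I w" using kw by (simp add: I_def L_def Suc)
  have inj_snoc: "inj_on (fac (w @ [b])) (I (w @ [b]))" if "e @ [b] \<notin> F w" for b
  proof -
    have "inj_on (fac (w @ [b])) (I w)"
      using inj fac_snoc[of _ b] by (simp add: inj_on_def)
    moreover have "fac (w @ [b]) ` I w = F w"
      using fac_snoc[of _ b] by (auto simp: F_def image_iff)
    ultimately show ?thesis
      using that L_notin by (simp add: I_snoc fac_L inj_on_insert)
  qed
  \<comment> \<open>Otherwise appending \<open>True\<close> to \<open>w\<close> would keep it
    \<open>good\<close>, against its maximal length. For \<open>eF\<close>, the last clause of
    \<open>good\<close> is met because of \<open>eT\<close>.\<close>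
  have eT: "e @ [True] \<in> F w"
  proof (rule ccontr)
    assume *: "e @ [True] \<notin> F w"
    have "good (w @ [True])"
      unfolding good_def F_snoc using pre kw inj_snoc[OF *] pref by auto
    from wmax[OF this] show False by simp
  qed
  have eF: "e @ [False] \<in> F w"
  proof (rule ccontr)
    assume *: "e @ [False] \<notin> F w"
    have "good (w @ [False])"
      unfolding good_def F_snoc using pre kw inj_snoc[OF *] pref eT by auto
    from wmax[OF this] show False by simp
  qed
  define occ where "occ v = {i. i + m \<le> length w \<and> take m (drop i w) = v}" for v
  have occ_pred: "w ! (i - 1) # v = fac w (i - 1) \<and> i - 1 \<in> I w" if "i \<in> occ v" "0 < i" for i v
    using that kw Suc by (cases i) (auto simp: occ_def fac_def I_def Cons_nth_drop_Suc[symmetric])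
  \<comment> \<open>Equal letters before two occurrences of \<open>v\<close> would make one factor
    of length \<open>k\<close> occur twice. With only two letters, \<open>v\<close> has at most two
    occurrences at positive positions, and if it has two, both words \<open>b # v\<close> are
    factors.\<close>
  have occ_inj: "w ! (i - 1) \<noteq> w ! (j - 1)"
    if "i \<in> occ v" "0 < i" "j \<in> occ v" "0 < j" "i \<noteq> j" for i j v
  proof
    assume eq: "w ! (i - 1) = w ! (j - 1)"
    have "fac w (i - 1) = w ! (i - 1) # v" using occ_pred[OF that(1,2)] by (rule conjunct1[THEN HOL.sym])
    also have "\<dots> = w ! (j - 1) # v" by (simp only: eq)
    also have "\<dots> = fac w (j - 1)" using occ_pred[OF that(3,4)] by (rule conjunct1)
    finally have "i - 1 = j - 1"
      using occ_pred[OF that(1,2)] occ_pred[OF that(3,4)] inj_onD[OF inj] by blast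
    then show False using that by simp
  qed
  have both: "b # v \<in> F w" if "i \<in> occ v" "0 < i" "j \<in> occ v" "0 < j" "i \<noteq> j" for b i j v
  proof -
    have "b = w ! (i - 1) \<or> b = w ! (j - 1)" using occ_inj[OF that] by blast
    then show ?thesis
      using occ_pred[OF that(1,2)] occ_pred[OF that(3,4)] unfolding F_def by (elim disjE) auto
  qed
  have occ0: "v = z" if "0 \<in> occ v" for v
  proof -
    have "take m w = take m (take k w)" by (simp add: Suc min_def)
    also have "\<dots> = z" unfolding pre by (simp add: z_def Suc del: replicate_Suc)
    finally show ?thesis using that by (simp add: occ_def)
  qed
  have occ_snoc: "\<exists>i. i \<in> occ v \<and> w ! (i + m) = b \<and> i < L" if "v @ [b] \<in> F w" for v b
  proof -
    from that obtain i where i: "i \<in> I w" "fac w i = v @ [b]" by (auto simp: F_def)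
    then have "take m (drop i w) @ [w ! (i + m)] = v @ [b]"
      by (simp add: fac_def I_def Suc take_Suc_conv_app_nth)
    then show ?thesis using i by (intro exI[of _ i]) (auto simp: occ_def I_def Suc L_def)
  qed
  have two: "\<exists>i j. i \<in> occ v \<and> j \<in> occ v \<and> i \<noteq> j \<and> i < L \<and> j < L"
    if "v @ [True] \<in> F w" "v @ [False] \<in> F w" for v
    using occ_snoc[OF that(1)] occ_snoc[OF that(2)] by metis
  obtain i j where ij: "i \<in> occ e" "j \<in> occ e" "i \<noteq> j" "i < L" "j < L"
    using two[OF eT eF] by blast
  have L: "L \<in> occ e" using kw Suc len_e by (auto simp: occ_def L_def e_def)
  \<comment> \<open>\<open>e\<close> occurs at the three positions \<open>i\<close>,
    \<open>j\<close> and \<open>L\<close>. If all were positive, they would need three distinct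
    preceding letters; so one occurrence is the prefix \<open>z\<close>.\<close>
  have e: "e = z"
  proof (rule ccontr)
    assume "e \<noteq> z"
    then have "0 < i" "0 < j" using occ0[of e] ij by (metis gr0I)+
    then show False
      using occ_inj[of i e j] occ_inj[of i e L] occ_inj[of j e L] ij L by auto
  qed
  have zF: "b # z \<in> F w" for b
  proof (cases "i = 0")
    case True then show ?thesis using both[of j e L b] ij L e by auto
  next
    case False then show ?thesis using both[of i e L b] ij L e by auto
  qed
  \<comment> \<open>A word \<open>v \<noteq> z\<close> that is followed by \<open>False\<close>
    somewhere is also followed by \<open>True\<close> somewhere, so it occurs twice, and not at
    position 0.\<close>
  have shift: "b # v \<in> F w" if vF: "v @ [False] \<in> F w" for b v
  proof (cases "v = z")
    case False
    then obtain i' j' where ij': "i' \<in> occ v" "j' \<in> occ v" "i' \<noteq> j'"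
      using two[of v] pref vF by blast
    then have "0 < i'" "0 < j'" using occ0[of v] False by (metis gr0I)+
    then show ?thesis using both ij' by blast
  qed (use zF in simp)
  have zeros: "replicate k False \<in> F w"
    unfolding F_def using kw pre by (intro image_eqI[of _ _ 0]) (auto simp: fac_def I_def)
  \<comment> \<open>Starting from \<open>replicate k False\<close>, \<open>shift\<close> drops a
    final \<open>False\<close> and puts any letter in front, until all of \<open>s\<close> has been
    prepended.\<close>
  have all: "s @ replicate (k - length s) False \<in> F w" if "length s \<le> k" for s
    using that
  proof (induction s)
    case Nil then show ?case using zeros by simp
  next
    case (Cons b s)
    have "replicate (k - length s) False = replicate (k - Suc (length s)) False @ [False]"
      using Cons.prems Suc_diff_Suc[of "length s" k] by (metis Suc_le_lessD length_Cons replicate_Suc replicate_append_same)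
    then have "(s @ replicate (k - Suc (length s)) False) @ [False] \<in> F w"
      using Cons by simp
    from shift[OF this] show ?case by simp
  qed
  have "s \<in> F w" if "length s = k" for s using all[of s] that by simp
  then have "F w = {s. length s = k}" using len_fac by blast
  then have "Suc (length w) - k = 2 ^ k" using cardF[OF w] words(2) by simp
  then have len: "length w = 2 ^ k + k - 1" using kw by linarith
  have "\<exists>p q. w = p @ s @ q" if "length s = k" for s
  proof -
    have "s \<in> F w" using all[of s] that by simp
    then obtain i where "s = take k (drop i w)" by (auto simp: F_def fac_def)
    then have "w = take i w @ s @ drop k (drop i w)" by (metis append_take_drop_id)
    then show ?thesis by blast
  qed
  with len show ?thesis by blast
qed

section \<open>An invariant of the stylic monoid\<close>

lemma sorted_wrt_subseq:
  assumes "subseq xs ys" "sorted_wrt R ys"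
  shows "sorted_wrt R xs"
  using assms
proof (induction rule: list_emb.induct)
  case (list_emb_Cons2 x y xs ys)
  then show ?case using list_emb_set[OF list_emb_Cons2.hyps(2)] by fastforce
qed simp_all

text \<open>Runs of consecutive letters are taken because cutting such a run gives two such runs, so
  that the set for \<open>u @ v\<close> is determined by those for \<open>u\<close> and
  \<open>v\<close>.\<close>

definition dec_runs :: "nat list \<Rightarrow> (nat \<times> nat) set" where
  "dec_runs u = {(i, j). subseq (rev [i..<j]) u}"

lemma rev_upt_split:
  assumes "rev [i..<j] = p @ q"
  shows "\<exists>k. p = rev [k..<j] \<and> q = rev [i..<k]"
proof -
  have e: "[i..<j] = rev q @ rev p" using assms by (metis rev_append rev_rev_ident)
  have "length [i..<j] = length q + length p" by (simp only: e) simp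
  then have "q = [] \<or> i + length q \<le> j" by (cases q) auto
  moreover have "rev q = take (length q) [i..<j]" "rev p = drop (length q) [i..<j]"
    by (simp_all add: e)
  ultimately have "p = rev [i + length q..<j]" "q = rev [i..<i + length q]"
    by (auto simp: rev_swap take_upt drop_upt)
  then show ?thesis by blast
qed

lemma mem_dec_runs_append:
  "(i, j) \<in> dec_runs (u @ v) \<longleftrightarrow> (\<exists>k. (k, j) \<in> dec_runs u \<and> (i, k) \<in> dec_runs v \<and> rev [i..<j] = rev [k..<j] @ rev [i..<k])"
proof
  assume "(i, j) \<in> dec_runs (u @ v)"
  then obtain p q where "rev [i..<j] = p @ q" "subseq p u" "subseq q v"
    by (auto simp: dec_runs_def subseq_append_iff)
  then show "\<exists>k. (k, j) \<in> dec_runs u \<and> (i, k) \<in> dec_runs v \<and> rev [i..<j] = rev [k..<j] @ rev [i..<k]"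
    using rev_upt_split[of i j p q] by (auto simp: dec_runs_def)
qed (auto simp: dec_runs_def subseq_append_iff)

lemma subseq_rev_upt_3:
  fixes x y z :: nat
  shows "subseq (rev [i..<j]) [x, y, z] \<longleftrightarrow>
    j \<le> i \<or> (j = Suc i \<and> i \<in> {x, y, z}) \<or>
    (j = i + 2 \<and> (x = Suc i \<and> (y = i \<or> z = i) \<or> (y = Suc i \<and> z = i))) \<or>
    (j = i + 3 \<and> x = i + 2 \<and> y = i + 1 \<and> z = i)"
proof -
  consider "j \<le> i" | "j = Suc i" | "j = i + 2" | "j = i + 3" | "j > i + 3" by linarith
  then show ?thesis
  proof cases
    case 5
    then have "length (rev [i..<j]) > 3" by simp
    then have "\<not> subseq (rev [i..<j]) [x, y, z]" using list_emb_length[of _ "rev [i..<j]" "[x,y,z]"] by auto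
    then show ?thesis using 5 by simp
  qed (auto simp: upt_rec numeral_2_eq_2 numeral_3_eq_3)
qed

text \<open>A run uses a letter at most once, so \<open>a a\<close> and \<open>a\<close> contain the
  same runs. A Knuth relation exchanges \<open>a\<close> and \<open>c\<close> with
  \<open>a < c\<close>; a run passing from \<open>c\<close> to \<open>a\<close> has
  \<open>c = a + 1\<close>, so \<open>b\<close> equals \<open>a\<close> or \<open>c\<close> and can
  replace it on the side where \<open>c\<close> comes after \<open>a\<close>.\<close>

lemma dec_runs_styl:
  assumes "(u, v) \<in> pres_cong {1..n} (knuth_rels n \<union> {([a, a], [a]) | a. a \<in> {1..n}})"
  shows "dec_runs u = dec_runs v"
  using assms
proof (induction rule: pres_cong.induct)
  case (base u v)
  show ?case
  proof (cases "\<exists>a. (u, v) = ([a, a], [a])")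
    case True
    then obtain a where "u = [a, a]" "v = [a]" by blast
    moreover have "subseq (rev [i..<j]) [a, a] \<longleftrightarrow> subseq (rev [i..<j]) [a]" for i j
    proof (cases "j \<le> Suc i")
      case True
      then show ?thesis by (cases "j = Suc i") auto
    next
      case False
      have "\<not> subseq (rev [i..<j]) v" if "set v \<subseteq> {a}" for v
      proof
        assume "subseq (rev [i..<j]) v"
        then have "set (rev [i..<j]) \<subseteq> {a}" using that list_emb_set[of "(=)" "rev [i..<j]" v] by blast
        then have "card {i..<j} \<le> card {a}" by (intro card_mono) auto
        then show False using False by simp
      qed
      then show ?thesis by simp
    qed
    ultimately show ?thesis by (simp add: dec_runs_def)
  next
    case False
    then have "(u, v) \<in> knuth_rels n" using base by auto
    then have "subseq (rev [i..<j]) u \<longleftrightarrow> subseq (rev [i..<j]) v" for i j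
      unfolding knuth_rels_def by (elim UnE CollectE exE conjE) (simp_all only: prod.inject subseq_rev_upt_3, auto)
    then show ?thesis by (simp add: dec_runs_def)
  qed
next
  case (append u v u' v')
  have "(i, j) \<in> dec_runs (u @ u') \<longleftrightarrow> (i, j) \<in> dec_runs (v @ v')" for i j
    by (simp add: mem_dec_runs_append append.IH)
  then show ?case by auto
qed simp_all

text \<open>A strictly decreasing word picks at most one letter from each increasing block.\<close>

lemma subseq_concat_blocks:
  fixes r :: "nat list"
  assumes "sorted_wrt (>) r" "\<And>b. sorted_wrt (<) (f b)" "subseq r (concat (map f w))"
  shows "\<exists>t. subseq t w \<and> list_all2 (\<lambda>x b. x \<in> set (f b)) r t"
  using assms(1,3)
proof (induction w arbitrary: r)
  case Nil
  then show ?case by auto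
next
  case (Cons b w)
  then obtain p q where r: "r = p @ q" "subseq p (f b)" "subseq q (concat (map f w))"
    by (auto simp: subseq_append_iff)
  from Cons.IH[of q] r Cons.prems obtain t where t: "subseq t w" "list_all2 (\<lambda>x b. x \<in> set (f b)) q t"
    by (auto simp: sorted_wrt_append)
  have "sorted_wrt (<) p" by (rule sorted_wrt_subseq[OF r(2) assms(2)])
  moreover have "sorted_wrt (>) p" using Cons.prems r by (simp add: sorted_wrt_append)
  ultimately have "\<not> 1 < length p"
    using sorted_wrt_nth_less[of "(<)" p 0 1] sorted_wrt_nth_less[of "(>)" p 0 1] by auto
  then consider "p = []" | x where "p = [x]"
    by (cases p; cases "tl p") simp_all
  then show ?case
  proof cases
    case 1
    then have "r = q" using r(1) by simp
    then show ?thesis using t list_emb_Cons by blast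
  next
    case 2
    then have "x \<in> set (f b)" using r(2) by (simp add: subseq_singleton_left)
    moreover have "r = x # q" using 2 r(1) by simp
    moreover have "subseq (b # t) (b # w)" using t(1) by simp
    ultimately show ?thesis using t(2) list_all2_Cons by blast
  qed
qed

lemma subseq_concat_map:
  assumes "subseq s w"
  shows "subseq (concat (map f s)) (concat (map f w))"
  using assms
proof (induction rule: list_emb.induct)
  case (list_emb_Cons xs ys y)
  then show ?case by (simp add: list_emb_append2)
next
  case (list_emb_Cons2 x y xs ys)
  then show ?case by (simp add: list_emb_append_mono)
qed simp

lemma subseq_concat_transversal:
  assumes "list_all2 (\<lambda>x b. x \<in> set (f b)) r t"
  shows "subseq r (concat (map f t))"
  using assms
proof induction
  case (Cons x xs b bs)
  have "subseq [x] (f b)" using Cons.hyps by (simp add: subseq_singleton_left)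
  from list_emb_append_mono[OF this Cons.IH] show ?case by simp
qed simp

text \<open>Letter \<open>e\<close> stands for position \<open>d - e\<close> of \<open>s\<close>, so
  the run from \<open>d\<close> down to 1 reads \<open>s\<close> from left to right. Each letter
  lies in the block of exactly one variable, so the variables whose blocks are used must spell
  \<open>s\<close>.\<close>

lemma subseq_concat_blocks_iff:
  assumes len: "length s = d" and f: "\<And>b. f b = filter (\<lambda>e. s ! (d - e) = b) [1..<Suc d]"
  shows "subseq (rev [1..<Suc d]) (concat (map f w)) \<longleftrightarrow> subseq s w"
proof -
  have inc: "sorted_wrt (<) (f b)" for b by (simp add: f sorted_wrt_filter del: upt_Suc)
  have nth: "rev [1..<Suc d] ! i = d - i" if "i < d" for i
    using that by (simp add: rev_nth del: upt_Suc)
  have mem: "e \<in> set (f b) \<longleftrightarrow> 1 \<le> e \<and> e \<le> d \<and> s ! (d - e) = b" for e b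
    by (auto simp add: f simp del: upt_Suc)
  have len_rev: "length (rev [1..<Suc d]) = d" by (simp del: upt_Suc)
  define r where "r = rev [1..<Suc d]"
  have r: "length r = d" "\<And>i. i < d \<Longrightarrow> r ! i = d - i" "sorted_wrt (>) r"
    unfolding r_def by (rule len_rev, rule nth, assumption) (simp add: sorted_wrt_rev del: upt_Suc)
  show ?thesis
    unfolding r_def[symmetric]
  proof
    assume "subseq r (concat (map f w))"
    from subseq_concat_blocks[OF r(3) inc this]
    obtain t where t: "subseq t w" "list_all2 (\<lambda>x b. x \<in> set (f b)) r t" by (elim exE conjE)
    have l: "length t = d" using list_all2_lengthD[OF t(2)] r(1) by simp
    have "t = s"
    proof (rule nth_equalityI)
      show "length t = length s" using l len by simp
      fix i assume "i < length t"
      then have i: "i < d" using l by simp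
      then have "r ! i \<in> set (f (t ! i))" using list_all2_nthD[OF t(2)] r(1) by simp
      then show "t ! i = s ! i" unfolding mem using i r(2)[OF i] by simp
    qed
    then show "subseq s w" using t by simp
  next
    assume s: "subseq s w"
    have "list_all2 (\<lambda>x b. x \<in> set (f b)) r s"
    proof (rule list_all2_all_nthI)
      show "length r = length s" using len r(1) by simp
      fix i assume "i < length r"
      then have i: "i < d" using r(1) by simp
      show "r ! i \<in> set (f (s ! i))" unfolding mem r(2)[OF i] using i by simp
    qed
    then have "subseq r (concat (map f s))" by (rule subseq_concat_transversal)
    then show "subseq r (concat (map f w))"
      using subseq_concat_map[OF s, of f] by (rule subseq_order.trans)
  qed
qed

section \<open>Tropical representations of the plactic monoid\<close>

text \<open>States are strictly increasing lists.  \<open>ach P Q u c\<close> says that the entry at \<open>(P, Q)\<close> of the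
  tropical matrix of \<open>u\<close> is at least \<open>c\<close>: along some chain of states from \<open>P\<close> to \<open>Q\<close>, at least \<open>c\<close>
  letters of \<open>u\<close> lie in an interval that some component sweeps in the corresponding step.  It is
  encoded by listing these letters, each paired with the index of the component as its colour.\<close>

definition rising :: "nat \<times> nat \<Rightarrow> nat \<times> nat \<Rightarrow> bool" where
  "rising p q \<longleftrightarrow> snd q < snd p \<or> fst p + (snd q - snd p) \<le> fst q"

definition box :: "nat list \<Rightarrow> nat list \<Rightarrow> nat \<Rightarrow> nat \<Rightarrow> bool" where
  "box P Q x i \<longleftrightarrow> i < length P \<and> P ! i \<le> x \<and> x \<le> Q ! i"

definition coloured :: "nat list \<Rightarrow> nat list \<Rightarrow> (nat \<times> nat) list \<Rightarrow> bool" where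
  "coloured P Q z \<longleftrightarrow> sorted_wrt rising z \<and> (\<forall>p\<in>set z. box P Q (fst p) (snd p))"

definition ach :: "nat list \<Rightarrow> nat list \<Rightarrow> nat list \<Rightarrow> nat \<Rightarrow> bool" where
  "ach P Q u c \<longleftrightarrow> sorted_wrt (<) P \<and> sorted_wrt (<) Q \<and> list_all2 (\<le>) P Q \<and>
     (\<exists>z. coloured P Q z \<and> subseq (map fst z) u \<and> c \<le> length z)"

section \<open>Max-plus multiplication and diagonal entries\<close>

lemma strict_sorted_gap:
  assumes "sorted_wrt (<) (P :: nat list)" "i \<le> j" "j < length P"
  shows "P ! i + (j - i) \<le> P ! j"
  using assms(2,3)
proof (induction j rule: dec_induct)
  case (step j)
  then have "P ! j < P ! Suc j" using assms(1) by (simp add: sorted_wrt_nth_less)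
  then show ?case using step by simp
qed simp

lemma coloured_Cons:
  "coloured P Q (p # z) \<longleftrightarrow> box P Q (fst p) (snd p) \<and> (\<forall>q\<in>set z. rising p q) \<and> coloured P Q z"
  by (auto simp: coloured_def)

lemma coloured_Nil: "coloured P Q []"
  by (simp add: coloured_def)

lemma ach_mono: "ach P Q u c \<Longrightarrow> c' \<le> c \<Longrightarrow> ach P Q u c'"
  unfolding ach_def using le_trans by blast

lemma ach_append_intro:
  assumes "ach P R u a" "ach R Q v b"
  shows "ach P Q (u @ v) (a + b)"
proof -
  from assms obtain y z where s: "sorted_wrt (<) P" "sorted_wrt (<) Q" "sorted_wrt (<) R"
    and le: "list_all2 (\<le>) P R" "list_all2 (\<le>) R Q"
    and y: "coloured P R y" "subseq (map fst y) u" "a \<le> length y"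
    and z: "coloured R Q z" "subseq (map fst z) v" "b \<le> length z"
    by (auto simp: ach_def)
  have len: "length R = length P" "length Q = length P"
    using list_all2_lengthD[OF le(1)] list_all2_lengthD[OF le(2)] by simp_all
  have PQ: "P ! i \<le> R ! i" "R ! i \<le> Q ! i" if "i < length P" for i
    using le that len by (auto dest: list_all2_nthD)
  \<comment> \<open>At the state \<open>R\<close>, component \<open>snd p\<close> has reached at
    least \<open>fst p\<close>. As \<open>R\<close> is strictly increasing, a component
    \<open>snd q \<ge> snd p\<close> is then at least \<open>fst p + (snd q - snd p)\<close>. This
    is the constraint that \<open>rising\<close> expresses.\<close>
  have r: "rising p q" if "p \<in> set y" "q \<in> set z" for p q
  proof -
    have "fst p \<le> R ! snd p" "R ! snd q \<le> fst q" "snd q < length R"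
      using that y(1) z(1) by (auto simp: coloured_def box_def)
    then show ?thesis
      using strict_sorted_gap[OF s(3), of "snd p" "snd q"]
      by (cases "snd p \<le> snd q") (simp_all add: rising_def)
  qed
  have "coloured P Q (y @ z)"
    unfolding coloured_def
  proof
    show "sorted_wrt rising (y @ z)"
      using r y(1) z(1) by (simp add: coloured_def sorted_wrt_append)
    show "\<forall>p\<in>set (y @ z). box P Q (fst p) (snd p)"
    proof
      fix p assume "p \<in> set (y @ z)"
      then have "box P R (fst p) (snd p) \<or> box R Q (fst p) (snd p)"
        using y(1) z(1) by (auto simp: coloured_def)
      then show "box P Q (fst p) (snd p)"
        using PQ[of "snd p"] by (auto simp: box_def len)
    qed
  qed
  moreover have "subseq (map fst (y @ z)) (u @ v)"
    using y(2) z(2) by (simp add: list_emb_append_mono)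
  moreover have "a + b \<le> length (y @ z)" using y z by simp
  moreover have "list_all2 (\<le>) P Q"
    using PQ len by (auto simp: list_all2_conv_all_nth intro: le_trans)
  ultimately show ?thesis using s unfolding ach_def by (intro conjI exI[of _ "y @ z"])
qed

text \<open>As intermediate state one takes the least one above \<open>P\<close> whose \<open>i\<close>-th component is at least
  \<open>x\<close> for every letter \<open>x\<close> of \<open>y\<close> of colour \<open>i\<close>.\<close>

lemma coloured_split:
  assumes s: "sorted_wrt (<) P" "sorted_wrt (<) Q" and le: "list_all2 (\<le>) P Q"
    and c: "coloured P Q (y @ z)"
  shows "\<exists>R. sorted_wrt (<) R \<and> list_all2 (\<le>) P R \<and> list_all2 (\<le>) R Q \<and> coloured P R y \<and> coloured R Q z"
proof -
  \<comment> \<open>A letter \<open>x\<close> of colour \<open>k \<le> i\<close> also bounds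
    component \<open>i\<close> from below, by \<open>x + (i - k)\<close>, since \<open>R\<close> is
    to be strictly increasing.\<close>
  define V where "V i = insert (P ! i) ((\<lambda>p. fst p + (i - snd p)) ` {p \<in> set y. snd p \<le> i})" for i
  define R where "R = map (\<lambda>i. Max (V i)) [0..<length P]"
  have V: "finite (V i)" "V i \<noteq> {}" for i by (simp_all add: V_def)
  have len: "length R = length P" "length Q = length P"
    using le by (auto simp: R_def dest: list_all2_lengthD)
  have R: "R ! i = Max (V i)" if "i < length P" for i using that by (simp add: R_def)
  have R_le: "R ! i \<le> t \<longleftrightarrow> P ! i \<le> t \<and> (\<forall>p\<in>set y. snd p \<le> i \<longrightarrow> fst p + (i - snd p) \<le> t)"
    if "i < length P" for i t
    using that by (auto simp: R Max_le_iff[OF V]) (auto simp: V_def)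
  have R_ge: "P ! i \<le> R ! i" "p \<in> set y \<Longrightarrow> snd p \<le> i \<Longrightarrow> fst p + (i - snd p) \<le> R ! i"
    if "i < length P" for i p
    using R_le[OF that, of "R ! i"] by auto
  have box: "box P Q (fst p) (snd p)" if "p \<in> set y \<union> set z" for p
    using that c by (auto simp: coloured_def)
  have R_less: "R ! i < R ! j" if ij: "i < j" "j < length P" for i j
  proof -
    have i: "i < length P" using ij by simp
    have "P ! i < P ! j" using s(1) ij by (rule sorted_wrt_nth_less)
    then have "P ! i \<le> R ! j - 1" using R_ge(1)[OF ij(2)] by simp
    moreover have "fst p + (i - snd p) \<le> R ! j - 1" if "p \<in> set y" "snd p \<le> i" for p
      using R_ge(2)[OF ij(2), of p] that ij by simp
    ultimately have "R ! i \<le> R ! j - 1" using R_le[OF i] by simp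
    moreover have "0 < R ! j" using \<open>P ! i < P ! j\<close> R_ge(1)[OF ij(2)] by simp
    ultimately show ?thesis by simp
  qed
  then have sR: "sorted_wrt (<) R" by (simp add: sorted_wrt_iff_nth_less len)
  have RQ: "R ! i \<le> Q ! i" if i: "i < length P" for i
  proof -
    have "P ! i \<le> Q ! i" using le i by (rule list_all2_nthD)
    moreover have "fst p + (i - snd p) \<le> Q ! i" if p: "p \<in> set y" "snd p \<le> i" for p
    proof -
      have "Q ! snd p + (i - snd p) \<le> Q ! i" using s(2) p i len by (intro strict_sorted_gap) auto
      moreover have "fst p \<le> Q ! snd p" using box p by (auto simp: box_def)
      ultimately show ?thesis by simp
    qed
    ultimately show ?thesis using R_le[OF i] by simp
  qed
  have "coloured P R y"
    unfolding coloured_def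
  proof
    show "sorted_wrt rising y" using c by (simp add: coloured_def sorted_wrt_append)
    show "\<forall>p\<in>set y. box P R (fst p) (snd p)"
      using box R_ge(2) by (fastforce simp: box_def)
  qed
  moreover have "coloured R Q z"
    unfolding coloured_def
  proof
    show "sorted_wrt rising z" using c by (simp add: coloured_def sorted_wrt_append)
    show "\<forall>q\<in>set z. box R Q (fst q) (snd q)"
    proof
      fix q assume q: "q \<in> set z"
      have "fst p + (snd q - snd p) \<le> fst q" if "p \<in> set y" "snd p \<le> snd q" for p
      proof -
        have "rising p q" using c that q by (auto simp: coloured_def sorted_wrt_append)
        then show ?thesis using that by (auto simp: rising_def)
      qed
      then show "box R Q (fst q) (snd q)" using box[of q] q R_le[of "snd q"] by (auto simp: box_def len)
    qed
  qed
  moreover have "list_all2 (\<le>) P R" "list_all2 (\<le>) R Q"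
    using R_ge(1) RQ by (auto simp: list_all2_conv_all_nth len)
  ultimately show ?thesis using sR by blast
qed

text \<open>This is max-plus matrix multiplication, with the intermediate state \<open>R\<close> as
  the index of summation; \<open>coloured_split\<close> finds it.\<close>

lemma ach_append:
  "ach P Q (u @ v) c \<longleftrightarrow> (\<exists>R a b. ach P R u a \<and> ach R Q v b \<and> c \<le> a + b)"
proof
  assume "ach P Q (u @ v) c"
  then obtain z where s: "sorted_wrt (<) P" "sorted_wrt (<) Q" "list_all2 (\<le>) P Q"
    and z: "coloured P Q z" "subseq (map fst z) (u @ v)" "c \<le> length z"
    by (auto simp: ach_def)
  from z(2) obtain p q where pq: "map fst z = p @ q" "subseq p u" "subseq q v"
    by (auto simp: subseq_append_iff)
  from pq(1) obtain x y where xy: "z = x @ y" "p = map fst x" "q = map fst y"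
    by (auto simp: map_eq_append_conv)
  obtain R where "sorted_wrt (<) R" "list_all2 (\<le>) P R" "list_all2 (\<le>) R Q" "coloured P R x" "coloured R Q y"
    using coloured_split[OF s] z(1) xy(1) by blast
  then have "ach P R u (length x)" "ach R Q v (length y)"
    using s pq xy unfolding ach_def by (blast intro: order_refl)+
  then show "\<exists>R a b. ach P R u a \<and> ach R Q v b \<and> c \<le> a + b"
    using z(3) xy(1) by auto
next
  assume "\<exists>R a b. ach P R u a \<and> ach R Q v b \<and> c \<le> a + b"
  then show "ach P Q (u @ v) c" using ach_append_intro ach_mono by blast
qed

text \<open>Between equal states each component sweeps only its own value, so the letters counted
  are those in \<open>P\<close>. Diagonal entries thus ignore the order of the letters, which makes
  them equal for \<open>A @ B\<close> and \<open>B @ A\<close>.\<close>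

lemma ach_diag:
  assumes "sorted_wrt (<) P"
  shows "ach P P u c \<longleftrightarrow> c \<le> length (filter (\<lambda>x. x \<in> set P) u)"
proof
  assume "ach P P u c"
  then obtain z where z: "coloured P P z" "subseq (map fst z) u" "c \<le> length z"
    by (auto simp: ach_def)
  have "x \<in> set P" if "x \<in> set (map fst z)" for x
  proof -
    from that obtain p where p: "p \<in> set z" "x = fst p" by auto
    then have "box P P (fst p) (snd p)" using z(1) by (simp add: coloured_def)
    then have "P ! snd p = x" "snd p < length P" using p by (auto simp: box_def)
    then show ?thesis by auto
  qed
  then have "filter (\<lambda>x. x \<in> set P) (map fst z) = map fst z" by (simp add: filter_id_conv)
  then have "subseq (map fst z) (filter (\<lambda>x. x \<in> set P) u)"
    using subseq_filter[OF z(2), of "\<lambda>x. x \<in> set P"] by simp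
  from list_emb_length[OF this] show "c \<le> length (filter (\<lambda>x. x \<in> set P) u)" using z(3) by simp
next
  assume c: "c \<le> length (filter (\<lambda>x. x \<in> set P) u)"
  have "\<exists>i. i < length P \<and> P ! i = x" if "x \<in> set P" for x
    using that by (auto simp: in_set_conv_nth)
  then obtain k where k: "\<And>x. x \<in> set P \<Longrightarrow> k x < length P \<and> P ! k x = x" by metis
  define z where "z = map (\<lambda>x. (x, k x)) (filter (\<lambda>x. x \<in> set P) u)"
  have "rising (x, k x) (y, k y)" if "x \<in> set P" "y \<in> set P" for x y
    using strict_sorted_gap[OF assms, of "k x" "k y"] k[OF that(1)] k[OF that(2)]
    by (cases "k x \<le> k y") (simp_all add: rising_def)
  then have "sorted_wrt rising z"
    unfolding z_def sorted_wrt_map by (intro sorted_wrt_mono_rel[OF _ sorted_wrt_true]) auto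
  moreover have "\<forall>p\<in>set z. box P P (fst p) (snd p)"
    using k by (auto simp: z_def box_def)
  moreover have "subseq (map fst z) u" by (simp add: z_def comp_def)
  moreover have "list_all2 (\<le>) P P" by (simp add: list_all2_refl)
  moreover have "c \<le> length z" using c by (simp add: z_def)
  ultimately show "ach P P u c" using assms unfolding ach_def coloured_def by blast
qed

section \<open>Invariance of the entries under the Knuth relations\<close>

lemma box_between:
  assumes "sorted_wrt (<) P" "sorted_wrt (<) Q" "length P = length Q"
    and "box P Q a i" "box P Q c k" "a \<le> b" "b \<le> c" "k \<le> j" "j \<le> i"
  shows "box P Q b j"
  using assms strict_sorted_gap[OF assms(1), of j i] strict_sorted_gap[OF assms(2), of k j]
  by (auto simp: box_def)

text \<open>The endpoints of the intervals grow by at least 1 per index: the lower bound follows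
  from \<open>P\<close> at \<open>k\<close>, the upper one from \<open>Q\<close> at
  \<open>i\<close>. The colour \<open>i + (c - a)\<close> is the largest that \<open>rising\<close>
  allows for \<open>c\<close> after \<open>a\<close> of colour \<open>i\<close>.\<close>

lemma box_shift:
  assumes "sorted_wrt (<) P" "sorted_wrt (<) Q" "length P = length Q"
    and "box P Q a i" "box P Q c k" "a \<le> c" "i + (c - a) \<le> k"
  shows "box P Q c (i + (c - a))"
  using assms strict_sorted_gap[OF assms(1), of "i + (c - a)" k] strict_sorted_gap[OF assms(2) le_add1[of i "c - a"]]
  by (auto simp: box_def)

lemma subseq_3_iff:
  "subseq w [x, y, z] \<longleftrightarrow> w \<in> {[], [x], [y], [z], [x, y], [x, z], [y, z], [x, y, z]}"
proof
  assume w: "subseq w [x, y, z]"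
  then have "length w \<le> 3" using list_emb_length by fastforce
  then consider "w = []" | a where "w = [a]" | a b where "w = [a, b]" | a b c where "w = [a, b, c]"
    by (cases w; cases "tl w"; cases "tl (tl w)"; cases "tl (tl (tl w))") auto
  then show "w \<in> {[], [x], [y], [z], [x, y], [x, z], [y, z], [x, y, z]}"
    using w by cases (auto split: if_splits)
qed auto

lemma map_fst_3:
  "map fst z = [a, b, c] \<Longrightarrow> \<exists>i j k. z = [(a, i), (b, j), (c, k)]"
  "map fst z = [a, b] \<Longrightarrow> \<exists>i j. z = [(a, i), (b, j)]"
  by (auto simp: map_eq_Cons_conv)

lemma subseq_swap_left_cases:
  assumes "subseq (map fst z) [x, y, t]"
  shows "subseq (map fst z) [y, x, t] \<or> (\<exists>i j. z = [(x, i), (y, j)]) \<or> (\<exists>i j k. z = [(x, i), (y, j), (t, k)])"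
proof -
  have "subseq (map fst z) [y, x, t] \<or> map fst z = [x, y] \<or> map fst z = [x, y, t]"
    using assms unfolding subseq_3_iff by auto
  then show ?thesis using map_fst_3 by metis
qed

lemma subseq_swap_right_cases:
  assumes "subseq (map fst z) [t, x, y]"
  shows "subseq (map fst z) [t, y, x] \<or> (\<exists>i j. z = [(x, i), (y, j)]) \<or> (\<exists>i j k. z = [(t, k), (x, i), (y, j)])"
proof -
  have "subseq (map fst z) [t, y, x] \<or> map fst z = [x, y] \<or> map fst z = [t, x, y]"
    using assms unfolding subseq_3_iff by auto
  then show ?thesis using map_fst_3 by metis
qed

text \<open>Only the number of letters is kept. Besides moving \<open>a\<close> and \<open>c\<close>
  past each other, the third letter \<open>b\<close> of a Knuth relation may have to replace one of
  them or lend it its colour.\<close>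

definition recoloured :: "nat list \<Rightarrow> nat list \<Rightarrow> nat list \<Rightarrow> nat list \<Rightarrow> bool" where
  "recoloured P Q u v \<longleftrightarrow> (\<forall>z. coloured P Q z \<longrightarrow> subseq (map fst z) u \<longrightarrow>
     (\<exists>y. coloured P Q y \<and> subseq (map fst y) v \<and> length y = length z))"

context
  fixes P Q :: "nat list"
  assumes s: "sorted_wrt (<) P" "sorted_wrt (<) Q" "length P = length Q"
begin

text \<open>If the colour of \<open>a\<close> is below that of \<open>c\<close>, the two can be
  swapped. Otherwise \<open>b\<close> replaces \<open>c\<close> in its colour, or, if
  \<open>b\<close> is already picked, \<open>a\<close> is given the colour of
  \<open>b\<close>.\<close>

lemma recoloured_acb_cab:
  assumes "a \<le> b" "b < c"
  shows "recoloured P Q [a, c, b] [c, a, b]"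
  unfolding recoloured_def
proof (intro allI impI)
  fix z assume z: "coloured P Q z" "subseq (map fst z) [a, c, b]"
  let ?thesis = "\<exists>y. coloured P Q y \<and> subseq (map fst y) [c, a, b] \<and> length y = length z"
  from subseq_swap_left_cases[OF z(2)]
  consider "subseq (map fst z) [c, a, b]" | i k where "z = [(a, i), (c, k)]" | i k j where "z = [(a, i), (c, k), (b, j)]"
    by (elim disjE exE)
  then show ?thesis
  proof cases
    case 1 then show ?thesis using z(1) by blast
  next
    case (2 i k)
    note zz = 2
    then have b: "box P Q a i" "box P Q c k" using z(1) by (auto simp: coloured_Cons)
    show ?thesis
    proof (cases "i < k")
      case True
      then show ?thesis using b zz
        by (intro exI[of _ "[(c, k), (a, i)]"]) (auto simp: coloured_Cons coloured_Nil rising_def)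
    next
      case False
      then have "box P Q b k" using box_between[OF s b, of b k] assms by simp
      then show ?thesis using b zz False assms
        by (intro exI[of _ "[(a, i), (b, k)]"]) (auto simp: coloured_Cons coloured_Nil rising_def)
    qed
  next
    case (3 i k j)
    note zz = 3
    then have b: "box P Q a i" "box P Q c k" "box P Q b j" and r: "rising (c, k) (b, j)" "rising (a, i) (b, j)"
      using z(1) by (auto simp: coloured_Cons)
    have jk: "j < k" using r(1) assms by (auto simp: rising_def)
    show ?thesis
    proof (cases "i < k")
      case True
      then show ?thesis using b r zz
        by (intro exI[of _ "[(c, k), (a, i), (b, j)]"]) (auto simp: coloured_Cons coloured_Nil rising_def)
    next
      case False
      then have "box P Q a j" using box_between[OF s b(1,3), of a j] assms jk by simp
      then show ?thesis using b r zz jk assms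
        by (intro exI[of _ "[(c, k), (a, j), (b, j)]"]) (auto simp: coloured_Cons coloured_Nil rising_def)
    qed
  qed
qed

text \<open>When \<open>c\<close> moves behind \<open>a\<close>, its colour is capped at
  \<open>i + (c - a)\<close>, which \<open>box_shift\<close> shows to be admissible. A following
  \<open>b\<close> stays compatible: its colour is below the cap because
  \<open>b < c\<close>.\<close>

lemma recoloured_cab_acb:
  assumes "a \<le> b" "b < c"
  shows "recoloured P Q [c, a, b] [a, c, b]"
  unfolding recoloured_def
proof (intro allI impI)
  fix z assume z: "coloured P Q z" "subseq (map fst z) [c, a, b]"
  let ?thesis = "\<exists>y. coloured P Q y \<and> subseq (map fst y) [a, c, b] \<and> length y = length z"
  from subseq_swap_left_cases[OF z(2)]
  consider "subseq (map fst z) [a, c, b]" | i k where "z = [(c, k), (a, i)]" | i k j where "z = [(c, k), (a, i), (b, j)]"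
    by (elim disjE exE)
  then show ?thesis
  proof cases
    case 1 then show ?thesis using z(1) by blast
  next
    case (2 i k)
    note zz = 2
    then have b: "box P Q a i" "box P Q c k" and r: "rising (c, k) (a, i)" using z by (auto simp: coloured_Cons)
    have ik: "i < k" using r assms by (auto simp: rising_def)
    define k' where "k' = min k (i + (c - a))"
    have "box P Q c k'"
      using box_shift[OF s b] b assms by (auto simp: k'_def min_def)
    moreover have "rising (a, i) (c, k')" using assms by (auto simp: rising_def k'_def)
    ultimately show ?thesis using b zz
      by (intro exI[of _ "[(a, i), (c, k')]"]) (auto simp: coloured_Cons coloured_Nil)
  next
    case (3 i k j)
    note zz = 3
    then have b: "box P Q a i" "box P Q c k" "box P Q b j"
      and r: "rising (c, k) (a, i)" "rising (c, k) (b, j)" "rising (a, i) (b, j)"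
      using z(1) by (auto simp: coloured_Cons)
    have ik: "i < k" "j < k" using r assms by (auto simp: rising_def)
    define k' where "k' = min k (i + (c - a))"
    have "box P Q c k'"
      using box_shift[OF s b(1,2)] b assms by (auto simp: k'_def min_def)
    moreover have "rising (a, i) (c, k')" using assms by (auto simp: rising_def k'_def)
    moreover have "j < k'" using ik r(3) assms by (auto simp: rising_def k'_def)
    ultimately show ?thesis using b zz r
      by (intro exI[of _ "[(a, i), (c, k'), (b, j)]"]) (auto simp: coloured_Cons coloured_Nil rising_def)
  qed
qed

text \<open>Dual to \<open>recoloured_acb_cab\<close>: if the swap is impossible, \<open>b\<close>
  replaces \<open>a\<close> in its colour, or, if \<open>b\<close> is already picked,
  \<open>c\<close> is given the colour of \<open>b\<close>.\<close>

lemma recoloured_bac_bca: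
  assumes "a < b" "b \<le> c"
  shows "recoloured P Q [b, a, c] [b, c, a]"
  unfolding recoloured_def
proof (intro allI impI)
  fix z assume z: "coloured P Q z" "subseq (map fst z) [b, a, c]"
  let ?thesis = "\<exists>y. coloured P Q y \<and> subseq (map fst y) [b, c, a] \<and> length y = length z"
  from subseq_swap_right_cases[OF z(2)]
  consider "subseq (map fst z) [b, c, a]" | i k where "z = [(a, i), (c, k)]" | i k j where "z = [(b, j), (a, i), (c, k)]"
    by (elim disjE exE)
  then show ?thesis
  proof cases
    case 1 then show ?thesis using z(1) by blast
  next
    case (2 i k)
    note zz = 2
    then have b: "box P Q a i" "box P Q c k" using z(1) by (auto simp: coloured_Cons)
    show ?thesis
    proof (cases "i < k")
      case True
      then show ?thesis using b zz
        by (intro exI[of _ "[(c, k), (a, i)]"]) (auto simp: coloured_Cons coloured_Nil rising_def)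
    next
      case False
      then have "box P Q b i" using box_between[OF s b, of b i] assms by simp
      then show ?thesis using b zz False assms
        by (intro exI[of _ "[(b, i), (c, k)]"]) (auto simp: coloured_Cons coloured_Nil rising_def)
    qed
  next
    case (3 i k j)
    note zz = 3
    then have b: "box P Q a i" "box P Q c k" "box P Q b j" and r: "rising (b, j) (a, i)" "rising (b, j) (c, k)"
      using z(1) by (auto simp: coloured_Cons)
    have ij: "i < j" using r(1) assms by (auto simp: rising_def)
    show ?thesis
    proof (cases "i < k")
      case True
      then show ?thesis using b r zz
        by (intro exI[of _ "[(b, j), (c, k), (a, i)]"]) (auto simp: coloured_Cons coloured_Nil rising_def)
    next
      case False
      then have "box P Q c j" using box_between[OF s b(3,2), of c j] assms ij by simp
      then show ?thesis using b r zz ij assms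
        by (intro exI[of _ "[(b, j), (c, j), (a, i)]"]) (auto simp: coloured_Cons coloured_Nil rising_def)
    qed
  qed
qed

text \<open>As in \<open>recoloured_cab_acb\<close>, the colour of \<open>c\<close> is capped; a
  preceding \<open>b\<close> stays compatible because lowering the colour of the later letter
  relaxes \<open>rising\<close>.\<close>

lemma recoloured_bca_bac:
  assumes "a < b" "b \<le> c"
  shows "recoloured P Q [b, c, a] [b, a, c]"
  unfolding recoloured_def
proof (intro allI impI)
  fix z assume z: "coloured P Q z" "subseq (map fst z) [b, c, a]"
  let ?thesis = "\<exists>y. coloured P Q y \<and> subseq (map fst y) [b, a, c] \<and> length y = length z"
  from subseq_swap_right_cases[OF z(2)]
  consider "subseq (map fst z) [b, a, c]" | i k where "z = [(c, k), (a, i)]" | i k j where "z = [(b, j), (c, k), (a, i)]"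
    by (elim disjE exE)
  then show ?thesis
  proof cases
    case 1 then show ?thesis using z(1) by blast
  next
    case (2 i k)
    note zz = 2
    then have b: "box P Q a i" "box P Q c k" and r: "rising (c, k) (a, i)" using z by (auto simp: coloured_Cons)
    define k' where "k' = min k (i + (c - a))"
    have "box P Q c k'"
      using box_shift[OF s b] b assms by (auto simp: k'_def min_def)
    moreover have "rising (a, i) (c, k')" using assms by (auto simp: rising_def k'_def)
    ultimately show ?thesis using b zz
      by (intro exI[of _ "[(a, i), (c, k')]"]) (auto simp: coloured_Cons coloured_Nil)
  next
    case (3 i k j)
    note zz = 3
    then have b: "box P Q a i" "box P Q c k" "box P Q b j"
      and r: "rising (b, j) (c, k)" "rising (b, j) (a, i)" "rising (c, k) (a, i)"
      using z(1) by (auto simp: coloured_Cons)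
    have ik: "i < k" "i < j" using r assms by (auto simp: rising_def)
    define k' where "k' = min k (i + (c - a))"
    have "box P Q c k'"
      using box_shift[OF s b(1,2)] b assms by (auto simp: k'_def min_def)
    moreover have "rising (a, i) (c, k')" using assms by (auto simp: rising_def k'_def)
    moreover have "rising (b, j) (c, k')" using ik r(1) assms by (auto simp: rising_def k'_def)
    ultimately show ?thesis using b zz r
      by (intro exI[of _ "[(b, j), (a, i), (c, k')]"]) (auto simp: coloured_Cons coloured_Nil)
  qed
qed

end

lemma ach_recoloured:
  assumes "\<And>P Q. sorted_wrt (<) P \<Longrightarrow> sorted_wrt (<) Q \<Longrightarrow> length P = length Q \<Longrightarrow> recoloured P Q u v"
    and "ach P Q u c"
  shows "ach P Q v c"
proof -
  from assms(2) obtain z where s: "sorted_wrt (<) P" "sorted_wrt (<) Q" "list_all2 (\<le>) P Q"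
    and z: "coloured P Q z" "subseq (map fst z) u" "c \<le> length z"
    by (auto simp: ach_def)
  have l: "length P = length Q" using s(3) by (rule list_all2_lengthD)
  from assms(1)[OF s(1,2) l] z obtain y where "coloured P Q y" "subseq (map fst y) v" "length y = length z"
    unfolding recoloured_def by blast
  then show ?thesis using s z(3) unfolding ach_def by auto
qed

lemma ach_knuth:
  assumes "(u, v) \<in> pres_cong {1..n} (knuth_rels n)"
  shows "ach P Q u c \<longleftrightarrow> ach P Q v c"
  using assms
proof (induction arbitrary: P Q c rule: pres_cong.induct)
  case (base u v)
  then consider a b c where "u = [a, c, b]" "v = [c, a, b]" "a \<le> b" "b < c"
    | a b c where "u = [b, a, c]" "v = [b, c, a]" "a < b" "b \<le> c"
    unfolding knuth_rels_def by auto
  then show ?case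
  proof cases
    case 1
    show ?thesis unfolding 1(1,2)
      by (rule iffI; erule ach_recoloured[rotated]) (simp_all add: recoloured_acb_cab recoloured_cab_acb 1)
  next
    case 2
    show ?thesis unfolding 2(1,2)
      by (rule iffI; erule ach_recoloured[rotated]) (simp_all add: recoloured_bac_bca recoloured_bca_bac 2)
  qed
next
  case (append u v u' v')
  show ?case unfolding ach_append append.IH by simp
qed simp_all

section \<open>Exchanging the middle factor\<close>

text \<open>\<open>st x P R a\<close> stands for the statement that the matrix entry of
  \<open>x\<close> at \<open>(P, R)\<close> is at least \<open>a\<close>; along a nonempty word,
  \<open>run\<close> says the same of the matrix product.\<close>

fun run :: "('x \<Rightarrow> 's \<Rightarrow> 's \<Rightarrow> nat \<Rightarrow> bool) \<Rightarrow> 's \<Rightarrow> 'x list \<Rightarrow> 's \<Rightarrow> nat \<Rightarrow> bool" where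
  "run st P [] Q c \<longleftrightarrow> P = Q \<and> c = 0"
| "run st P (x # w) Q c \<longleftrightarrow> (\<exists>R a b. st x P R a \<and> run st R w Q b \<and> c \<le> a + b)"

lemma run_mono: "run st P w Q c \<Longrightarrow> c' \<le> c \<Longrightarrow> run st P w Q c'"
  by (cases w) (simp_all, meson le_trans)

lemma run_Cons: "st x P R a \<Longrightarrow> run st R w Q b \<Longrightarrow> c \<le> a + b \<Longrightarrow> run st P (x # w) Q c"
  by auto

lemma run_append: "run st P u R a \<Longrightarrow> run st R v Q b \<Longrightarrow> run st P (u @ v) Q (a + b)"
proof (induction u arbitrary: P a)
  case (Cons x u)
  then obtain S d e where "st x P S d" "run st S u R e" "a \<le> d + e" by auto
  moreover from Cons.IH[OF this(2) Cons.prems(2)] have "run st S (u @ v) Q (e + b)" .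
  ultimately show ?case by (simp only: append_Cons) (rule run_Cons, assumption+, simp)
qed simp

lemma run_rev: "run (\<lambda>x P Q. st x Q P) P (rev w) Q c \<Longrightarrow> run st Q w P c"
proof (induction w arbitrary: Q c)
  case (Cons x w)
  \<comment> \<open>Splits the last letter off a run, for any step relation \<open>f\<close>, as it
    is applied to the transposed one.\<close>
  have "\<exists>R a b. run f P (u @ [x]) Q c \<longrightarrow> run f P u R a \<and> f x R Q b \<and> c \<le> a + b"
    for f :: "'a \<Rightarrow> 'b \<Rightarrow> 'b \<Rightarrow> nat \<Rightarrow> bool" and P Q u c
  proof (induction u arbitrary: P c)
    case Nil
    then show ?case by fastforce
  next
    case (Cons y u)
    show ?case
    proof (cases "run f P ((y # u) @ [x]) Q c")
      case True
      then obtain S d e where S: "f y P S d" "run f S (u @ [x]) Q e" "c \<le> d + e" by auto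
      from Cons.IH[of S e] S(2) obtain R a b where "run f S u R a" "f x R Q b" "e \<le> a + b" by blast
      then have "run f P (y # u) R (d + a) \<and> f x R Q b \<and> c \<le> (d + a) + b" using S by auto
      then show ?thesis by blast
    qed blast
  qed
  then obtain R a b where R: "run (\<lambda>x P Q. st x Q P) P (rev w) R a" "st x Q R b" "c \<le> a + b"
    using Cons.prems by (metis rev.simps(2))
  from run_Cons[of st, OF R(2) Cons.IH[OF R(1)]] R(3) show ?case by simp
qed simp

text \<open>The letters will be the blocks \<open>A @ B\<close> and \<open>B @ A\<close>, the states
  strictly increasing lists. The point is that the stay weight \<open>D P\<close> does not depend on
  the letter.\<close>

locale stay_runs =
  fixes st :: "'x \<Rightarrow> 's \<Rightarrow> 's \<Rightarrow> nat \<Rightarrow> bool" and ok :: "'s \<Rightarrow> bool" and D :: "'s \<Rightarrow> nat"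
  assumes st_ok: "st x P Q a \<Longrightarrow> ok P \<and> ok Q"
    and stay_iff: "ok P \<Longrightarrow> st x P P a \<longleftrightarrow> a \<le> D P"
begin

text \<open>\<open>moves N P u s Q c\<close>: a run over \<open>u\<close> of weight \<open>c\<close> that moves at the letters \<open>s\<close> and stays only
  at states of stay weight at most \<open>N\<close>.\<close>

inductive moves :: "nat \<Rightarrow> 's \<Rightarrow> 'x list \<Rightarrow> 'x list \<Rightarrow> 's \<Rightarrow> nat \<Rightarrow> bool" for N where
  Nil: "ok P \<Longrightarrow> moves N P [] [] P 0"
| stay: "D P \<le> N \<Longrightarrow> a \<le> D P \<Longrightarrow> moves N P u s Q c \<Longrightarrow> moves N P (x # u) s Q (a + c)"
| move: "st x P R a \<Longrightarrow> moves N R u s Q c \<Longrightarrow> moves N P (x # u) (x # s) Q (a + c)"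

lemma moves_ok: "moves N P u s Q c \<Longrightarrow> ok P \<and> ok Q"
  by (induction rule: moves.induct) (auto dest: st_ok)

lemma moves_mono: "moves N P u s Q c \<Longrightarrow> N \<le> N' \<Longrightarrow> moves N' P u s Q c"
  by (induction rule: moves.induct) (auto intro: moves.intros)

lemma moves_append:
  "moves N P u s R a \<Longrightarrow> moves N R v t Q b \<Longrightarrow> moves N P (u @ v) (s @ t) Q (a + b)"
  by (induction rule: moves.induct) (auto intro: moves.intros simp: add.assoc)

lemma moves_run: "moves N P u s Q c \<Longrightarrow> run st P u Q c"
proof (induction rule: moves.induct)
  case (stay P a u s Q c x)
  then have "st x P P a" using stay_iff moves_ok by blast
  then show ?case using stay by auto
qed auto

text \<open>The moves alone form a run over \<open>s\<close>; each of the
  \<open>length u - length s\<close> stays left out weighs at most \<open>N\<close>. The terms are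
  arranged to avoid subtraction.\<close>

lemma moves_run_letters:
  "moves N P u s Q c \<Longrightarrow> \<exists>b. run st P s Q b \<and> c + length s * N \<le> b + length u * N"
proof (induction rule: moves.induct)
  case (stay P a u s Q c x)
  then obtain b where b: "run st P s Q b" "c + length s * N \<le> b + length u * N" by blast
  have "a \<le> N" using stay by simp
  then show ?case using b by (intro exI[of _ b]) simp
next
  case (move x P R a u s Q c)
  then obtain b where "run st R s Q b" "c + length s * N \<le> b + length u * N" by blast
  then show ?case using move by (intro exI[of _ "a + b"]) auto
qed auto

lemma run_stay: "ok P \<Longrightarrow> run st P u P (length u * D P)"
proof (induction u)
  case (Cons x u)
  then have "st x P P (D P)" by (simp add: stay_iff)
  from run_Cons[of st, OF this Cons.IH[OF Cons.prems]] show ?case by simp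
qed simp

text \<open>No stay on the way weighs more than one at \<open>Q\<close>, so it is best to make the moves \<open>s\<close> in a row at
  their occurrence as a factor; if the given run moves before that, follow it and recurse.\<close>

lemma moves_exchange:
  assumes "moves (D Q) P (w @ z) s Q c" "w = p @ s @ q"
  shows "\<exists>b. run st P w Q b \<and> c \<le> b + length z * D Q"
  using assms
proof (induction w arbitrary: P s p c)
  case Nil
  from moves_run_letters[OF Nil(1)] Nil(2) show ?case by auto
next
  case (Cons x w)
  show ?case
  proof (cases p)
    \<comment> \<open>Here \<open>w\<close> begins with the moves \<open>s\<close>: make them first,
      then stay at \<open>Q\<close> for the rest \<open>q\<close>. Each of these stays weighs
      \<open>D Q\<close>, at least as much as any stay of the given run.\<close>
    case Nil
    from moves_run_letters[OF Cons.prems(1)] obtain b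
      where b: "run st P s Q b" "c + length s * D Q \<le> b + length ((x # w) @ z) * D Q" by blast
    have "run st P (s @ q) Q (b + length q * D Q)"
      using run_append[OF b(1) run_stay] moves_ok[OF Cons.prems(1)] by blast
    moreover have "x # w = s @ q" using Cons.prems(2) Nil by simp
    moreover have "length ((x # w) @ z) * D Q = (length s + length q + length z) * D Q"
      using \<open>x # w = s @ q\<close> by (metis length_append)
    ultimately show ?thesis
      using b(2) by (intro exI[of _ "b + length q * D Q"]) (simp add: algebra_simps)
  next
    case (Cons y p')
    then have w: "w = p' @ s @ q" "y = x" using Cons.prems(2) by simp_all
    from Cons.prems(1) have "moves (D Q) P (x # (w @ z)) s Q c" by simp
    then show ?thesis
    proof cases
      case (stay a c')
      from Cons.IH[OF stay(4) w(1)] obtain b where b: "run st P w Q b" "c' \<le> b + length z * D Q"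
        by blast
      have "st x P P a" using stay stay_iff moves_ok by blast
      then show ?thesis using b stay by (intro exI[of _ "a + b"]) auto
    next
      case (move R a s' c')
      \<comment> \<open>The run has made the first move of \<open>s\<close>, at the letter
        \<open>x\<close>. Since the factor \<open>s\<close> also begins with \<open>x\<close>, the
        rest \<open>s'\<close> is again a factor of the remaining word.\<close>
      have "w = (p' @ [x]) @ s' @ q" using w(1) move by simp
      from Cons.IH[OF _ this, of R c'] move obtain b
        where "run st R w Q b" "c' \<le> b + length z * D Q" by blast
      then show ?thesis using move by (intro exI[of _ "a + b"]) auto
    qed
  qed
qed

text \<open>Built from the end of the run: \<open>R\<close> is the best state of the rest, unless
  the first state \<open>P\<close> has a larger stay weight and takes its place. Strict steps raise
  the rank, so rank differences bound the number of moves on either side.\<close>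

lemma run_split_at_best_state:
  assumes rk: "\<forall>x P Q a. st x P Q a \<longrightarrow> P \<noteq> Q \<longrightarrow> rk P < (rk Q :: nat)"
    and "run st P u Q c" "ok P"
  shows "\<exists>u1 u2 R s1 s2 c1 c2. u = u1 @ u2 \<and> moves (D R) P u1 s1 R c1 \<and> moves (D R) R u2 s2 Q c2
     \<and> c \<le> c1 + c2 \<and> length s1 + rk P \<le> rk R \<and> length s2 + rk R \<le> rk Q"
  using assms(2,3)
proof (induction u arbitrary: P c)
  case Nil
  then show ?case by (intro exI[of _ "[]"] exI[of _ P] exI[of _ 0]) (auto intro: moves.Nil)
next
  case (Cons x u)
  then obtain S a b where S: "st x P S a" "run st S u Q b" "c \<le> a + b" by auto
  from Cons.IH[OF S(2)] st_ok[OF S(1)] obtain u1 u2 R s1 s2 c1 c2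
    where IH: "u = u1 @ u2" "moves (D R) S u1 s1 R c1" "moves (D R) R u2 s2 Q c2" "b \<le> c1 + c2"
      "length s1 + rk S \<le> rk R" "length s2 + rk R \<le> rk Q" by blast
  \<comment> \<open>A step from a state to itself is treated as a stay and not recorded as a
    move.\<close>
  define t where "t = (if P = S then [] else [x])"
  have t: "length t + rk P \<le> rk S" using rk S(1) by (auto simp: t_def Suc_le_eq)
  have first: "moves N P (x # v) (t @ s) Q' (a + d)" if "moves N S v s Q' d" "D P \<le> N" for N v s Q' d
    using that S(1) stay_iff Cons.prems(2) by (auto simp: t_def intro: moves.intros)
  show ?case
  proof (cases "D P \<le> D R")
    case True
    have "moves (D R) P (x # u1) (t @ s1) R (a + c1)" by (rule first[OF IH(2) True])
    moreover have "x # u = (x # u1) @ u2" "c \<le> (a + c1) + c2" "length (t @ s1) + rk P \<le> rk R"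
      using IH S t by simp_all
    ultimately show ?thesis using IH(3,6) by blast
  next
    case False
    have "moves (D P) S u (s1 @ s2) Q (c1 + c2)"
      using moves_mono[OF moves_append[OF IH(2,3)]] False IH(1) by simp
    then have "moves (D P) P (x # u) (t @ s1 @ s2) Q (a + (c1 + c2))" by (rule first) simp
    moreover have "moves (D P) P [] [] P 0" using Cons.prems(2) by (rule moves.Nil)
    moreover have "x # u = [] @ x # u" "c \<le> 0 + (a + (c1 + c2))" "length [] + rk P \<le> rk P"
      "length (t @ s1 @ s2) + rk P \<le> rk Q"
      using IH S t by simp_all
    ultimately show ?thesis by blast
  qed
qed

end

lemma moves_rev:
  assumes "stay_runs st ok D" "stay_runs.moves st ok D N P u s Q c"
  shows "stay_runs.moves (\<lambda>x P Q. st x Q P) ok D N Q (rev u) (rev s) P c"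
proof -
  interpret stay_runs st ok D by fact
  interpret c: stay_runs "\<lambda>x P Q. st x Q P" ok D
    by unfold_locales (use st_ok stay_iff in auto)
  show ?thesis using assms(2)
  proof (induction rule: moves.induct)
    case (Nil P)
    then show ?case by (simp add: c.moves.Nil)
  next
    case (stay P a u s Q c x)
    have "c.moves N P [x] [] P (a + 0)" using stay moves_ok by (intro c.moves.intros) auto
    from c.moves_append[OF stay.IH this] show ?case by (simp add: add.commute)
  next
    case (move x P R a u s Q c)
    have "ok P" using st_ok[OF move.hyps(1)] by simp
    from c.moves.move[OF move.hyps(1) c.moves.Nil[OF this]] have "c.moves N R [x] [x] P (a + 0)" .
    from c.moves_append[OF move.IH this] show ?case by (simp add: add.commute)
  qed
qed

text \<open>The cut at the best state \<open>R\<close> leaves the middle letter on one side,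
  together with a full copy of \<open>w\<close>. The moves on that side fit into this copy as a
  factor, so the middle letter can be read while staying at \<open>R\<close>, where \<open>x\<close>
  and \<open>y\<close> weigh the same.\<close>

lemma (in stay_runs) run_exchange_middle:
  assumes rk: "\<forall>x P Q a. st x P Q a \<longrightarrow> P \<noteq> Q \<longrightarrow> rk P < (rk Q :: nat)"
    and w: "\<And>s. length s = k \<Longrightarrow> \<exists>p q. w = p @ s @ q"
    and run: "run st P (w @ [x] @ w) Q c" and PQ: "rk Q \<le> rk P + k"
  shows "run st P (w @ [y] @ w) Q c"
proof -
  interpret c: stay_runs "\<lambda>x P Q. st x Q P" ok D
    by unfold_locales (use st_ok stay_iff in auto)
  \<comment> \<open>Shorter words are padded to length \<open>k\<close> with an arbitrary letter,
    here \<open>y\<close>.\<close>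
  have factor: "\<exists>p q. w = p @ s @ q" if "length s \<le> k" for s
  proof -
    have "length (s @ replicate (k - length s) y) = k" using that by simp
    from w[OF this] obtain p q where "w = p @ (s @ replicate (k - length s) y) @ q" by (elim exE)
    then have "w = p @ s @ (replicate (k - length s) y @ q)" by simp
    then show ?thesis by (intro exI)
  qed
  have "ok P"
  proof (cases w)
    case Nil then show ?thesis using run st_ok by auto
  next
    case (Cons b v) then show ?thesis using run st_ok by auto
  qed
  from run_split_at_best_state[OF rk run this] obtain u1 u2 R s1 s2 c1 c2
    where u: "w @ [x] @ w = u1 @ u2" and m: "moves (D R) P u1 s1 R c1" "moves (D R) R u2 s2 Q c2"
      and c: "c \<le> c1 + c2" and s: "length s1 + rk P \<le> rk R" "length s2 + rk R \<le> rk Q"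
    by (elim exE conjE)
  have ok: "ok R" using moves_ok[OF m(1)] by simp
  have k: "length s1 \<le> k" "length s2 \<le> k" using s PQ by simp_all
  from u obtain v where "w = u1 @ v \<and> v @ x # w = u2 \<or> w @ v = u1 \<and> x # w = v @ u2"
    unfolding append_eq_append_conv2 append_Cons append_Nil by (elim exE)
  \<comment> \<open>The cut lies after the middle letter or before it; a cut directly before it
    belongs to the second case. That case is the mirror image and is handled by transposing the step
    relation.\<close>
  then consider v where "u1 = w @ x # v" "w = v @ u2" | v where "u2 = v @ x # w" "w = u1 @ v"
    by (cases v) fastforce+
  then show ?thesis
  proof cases
    case (1 w')
    obtain p q where "w = p @ s1 @ q" using factor[OF k(1)] by blast
    from moves_exchange[OF _ this, of R P "x # w'" c1] m(1) 1(1) obtain b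
      where b: "run st P w R b" "c1 \<le> b + length (x # w') * D R" by auto
    have "run st P (w @ (y # w') @ u2) Q (b + (length (y # w') * D R + c2))"
      using run_append[OF b(1) run_append[OF run_stay[OF ok] moves_run[OF m(2)]]] .
    from run_mono[OF this, of c] have "run st P (w @ (y # w') @ u2) Q c" using b(2) c by simp
    moreover have "w @ (y # w') @ u2 = w @ [y] @ w" using 1(2) by simp
    ultimately show ?thesis by (simp only:)
  next
    case (2 w')
    obtain p q where "w = p @ s2 @ q" using factor[OF k(2)] by blast
    then have rw: "rev w = rev q @ rev s2 @ rev p" by simp
    have "c.moves (D R) Q (rev w @ (x # rev w')) (rev s2) R c2"
      using moves_rev[OF stay_runs_axioms m(2)] 2(1) by simp
    from c.moves_exchange[OF this rw] obtain b
      where b: "run (\<lambda>x P Q. st x Q P) Q (rev w) R b" "c2 \<le> b + length (x # rev w') * D R" by blast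
    have "run st P (u1 @ (w' @ [y]) @ w) Q (c1 + (length (w' @ [y]) * D R + b))"
      using run_append[OF moves_run[OF m(1)] run_append[OF run_stay[OF ok] run_rev[OF b(1)]]] .
    from run_mono[OF this, of c] have "run st P (u1 @ (w' @ [y]) @ w) Q c" using b(2) c by simp
    moreover have "u1 @ (w' @ [y]) @ w = w @ [y] @ w" using 2(2) by simp
    ultimately show ?thesis by (simp only:)
  qed
qed

section \<open>Column insertion and tableaux\<close>

abbreviation plactic :: "nat \<Rightarrow> (nat list \<times> nat list) set" where
  "plactic n \<equiv> pres_cong {1..n} (knuth_rels n)"

lemma plactic_left: "(u, v) \<in> plactic n \<Longrightarrow> set w \<subseteq> {1..n} \<Longrightarrow> (w @ u, w @ v) \<in> plactic n"
  by (intro pres_cong.append pres_cong.refl) auto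

lemma plactic_right: "(u, v) \<in> plactic n \<Longrightarrow> set w \<subseteq> {1..n} \<Longrightarrow> (u @ w, v @ w) \<in> plactic n"
  by (intro pres_cong.append pres_cong.refl) auto

text \<open>\<open>x\<close> passes the letters of \<open>A\<close> one by one: in
  \<open>x a b = a x b\<close> the witness \<open>b\<close> is the letter following
  \<open>a\<close>.\<close>

lemma plactic_bump_past_larger:
  assumes "sorted_wrt (>) (A @ [y])" "x \<le> y" "set A \<union> {x, y} \<subseteq> {1..n}"
  shows "(x # A @ [y], A @ [x, y]) \<in> plactic n"
  using assms
proof (induction A)
  case Nil
  then show ?case by (auto intro!: pres_cong.refl)
next
  case (Cons a A)
  obtain b r where br: "A @ [y] = b # r" by (cases "A @ [y]") auto
  have "b \<in> set (A @ [y])" by (simp add: br)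
  then have "x \<le> b" "b < a" "b \<in> {1..n}" using Cons.prems by (auto simp: sorted_wrt_append)
  then have "([x, a, b], [a, x, b]) \<in> plactic n"
    using Cons.prems(3) by (intro pres_cong.base) (auto simp: knuth_rels_def)
  moreover have "set r \<subseteq> set (A @ [y])" unfolding br by auto
  then have "set r \<subseteq> {1..n}" using Cons.prems(3) by auto
  ultimately have "([x, a, b] @ r, [a, x, b] @ r) \<in> plactic n" by (rule plactic_right)
  then have "(x # (a # A) @ [y], [a] @ (x # A @ [y])) \<in> plactic n" using br by simp
  moreover have "([a] @ (x # A @ [y]), [a] @ (A @ [x, y])) \<in> plactic n"
    using Cons by (intro plactic_left Cons.IH) auto
  ultimately show ?case using pres_cong.trans by fastforce
qed

text \<open>\<open>y\<close> passes the letters of \<open>B\<close> one by one; the witness in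
  \<open>x y b = x b y\<close> is the letter just before \<open>y\<close>, first \<open>x\<close>
  and then the letter passed last.\<close>

lemma plactic_bump_past_smaller:
  assumes "sorted_wrt (>) (x # B)" "x \<le> y" "set B \<union> {x, y} \<subseteq> {1..n}"
  shows "([x, y] @ B, x # B @ [y]) \<in> plactic n"
  using assms
proof (induction B arbitrary: x)
  case Nil
  then show ?case by (auto intro!: pres_cong.refl)
next
  case (Cons b B)
  have "([x, y, b], [x, b, y]) \<in> plactic n"
    using Cons.prems by (intro pres_cong.sym[OF pres_cong.base]) (auto simp: knuth_rels_def)
  then have "([x, y, b] @ B, [x, b, y] @ B) \<in> plactic n"
    using Cons.prems by (intro plactic_right) auto
  moreover have "([x] @ ([b, y] @ B), [x] @ (b # B @ [y])) \<in> plactic n"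
    using Cons.prems by (intro plactic_left Cons.IH) auto
  ultimately show ?case using pres_cong.trans by fastforce
qed

text \<open>One step of column insertion: \<open>x\<close> takes the place of \<open>y\<close> in
  the column, and \<open>y\<close> leaves it to be inserted into the next one.\<close>

lemma plactic_bump:
  assumes "sorted_wrt (>) (A @ y # B)" "x \<le> y" "\<forall>b\<in>set B. b < x" "set A \<union> set B \<union> {x, y} \<subseteq> {1..n}"
  shows "(x # A @ y # B, A @ x # B @ [y]) \<in> plactic n"
proof -
  have "(x # A @ [y], A @ [x, y]) \<in> plactic n"
    using assms by (intro plactic_bump_past_larger) (auto simp: sorted_wrt_append)
  then have "((x # A @ [y]) @ B, (A @ [x, y]) @ B) \<in> plactic n"
    by (rule plactic_right) (use assms in auto)
  moreover have "([x, y] @ B, x # B @ [y]) \<in> plactic n"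
    using assms by (intro plactic_bump_past_smaller) (auto simp: sorted_wrt_append)
  then have "(A @ ([x, y] @ B), A @ (x # B @ [y])) \<in> plactic n"
    by (rule plactic_left) (use assms in auto)
  ultimately show ?thesis using pres_cong.trans by fastforce
qed

section \<open>Tableaux and Schensted's column insertion\<close>

definition column_word :: "nat set \<Rightarrow> nat list" where
  "column_word C = rev (sorted_list_of_set C)"

lemma set_column_word: "finite C \<Longrightarrow> set (column_word C) = C"
  by (simp add: column_word_def)

lemma sorted_column_word: "sorted_wrt (>) (column_word C)"
  by (simp add: column_word_def sorted_wrt_rev)

lemma column_word_unique: "sorted_wrt (>) w \<Longrightarrow> column_word (set w) = w"
  using sorted_list_of_set_unique[of "set w" "rev w"]
  by (auto simp: column_word_def sorted_wrt_rev rev_swap intro: strict_sorted_equal)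

text \<open>Columns are finite sets of entries.  A column dominates the next one of a tableau iff it is at
  least as long and entrywise at most as large; this is the pointwise inequality of their counting functions.\<close>

definition count_le :: "nat set \<Rightarrow> nat \<Rightarrow> nat" where
  "count_le C j = card (C \<inter> {..j})"

definition dominates :: "nat set \<Rightarrow> nat set \<Rightarrow> bool" where
  "dominates C D \<longleftrightarrow> (\<forall>j. count_le D j \<le> count_le C j)"

definition tableau :: "nat \<Rightarrow> nat set list \<Rightarrow> bool" where
  "tableau n cs \<longleftrightarrow> (\<forall>C\<in>set cs. C \<noteq> {} \<and> C \<subseteq> {1..n}) \<and> sorted_wrt dominates cs"

definition tableau_word :: "nat set list \<Rightarrow> nat list" where
  "tableau_word cs = concat (map column_word cs)"

text \<open>Insertion multiplies the word of the tableau by \<open>x\<close> on the left, up to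
  plactic congruence. An entry equal to \<open>x\<close> is bumped as well, since the entries of a
  column are distinct.\<close>

fun column_insert :: "nat \<Rightarrow> nat set list \<Rightarrow> nat set list" where
  "column_insert x [] = [{x}]"
| "column_insert x (C # cs) =
    (if \<forall>z\<in>C. z < x then insert x C # cs
     else let y = Min {z \<in> C. x \<le> z} in insert x (C - {y}) # column_insert y cs)"

lemma dominates_trans: "dominates A B \<Longrightarrow> dominates B C \<Longrightarrow> dominates A C"
  unfolding dominates_def using le_trans by blast

lemma tableau_Cons2:
  "tableau n (C # D # cs) \<longleftrightarrow> C \<noteq> {} \<and> C \<subseteq> {1..n} \<and> dominates C D \<and> tableau n (D # cs)"
  by (auto simp: tableau_def intro: dominates_trans)

lemma least_above:
  fixes z :: nat
  assumes "finite C" "\<not> (\<forall>z\<in>C. z < x)"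
  shows "Min {z \<in> C. x \<le> z} \<in> C" "x \<le> Min {z \<in> C. x \<le> z}"
    "z \<in> C \<Longrightarrow> z < Min {z \<in> C. x \<le> z} \<Longrightarrow> z < x"
proof -
  have f: "finite {z \<in> C. x \<le> z}" "{z \<in> C. x \<le> z} \<noteq> {}" using assms by (auto simp: not_less)
  show "Min {z \<in> C. x \<le> z} \<in> C" "x \<le> Min {z \<in> C. x \<le> z}" using Min_in[OF f] by auto
  show "z < x" if "z \<in> C" "z < Min {z \<in> C. x \<le> z}"
    using that Min_le[OF f(1), of z] by (auto simp: not_less[symmetric])
qed

lemma count_le_bump:
  assumes "finite C" "y \<in> C" "x \<le> y" "\<forall>z\<in>C. z < y \<longrightarrow> z < x"
  shows "count_le C j \<le> count_le (insert x (C - {y})) j"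
proof (cases "y \<le> j")
  case True
  have "x = y \<or> x \<notin> C" using assms(3,4) by fastforce
  moreover have "insert x (C - {y}) \<inter> {..j} = insert x (C \<inter> {..j} - {y})" using True assms by auto
  ultimately show ?thesis using assms True
    by (auto simp: count_le_def card_insert_if card_Suc_Diff1 insert_absorb)
next
  case False
  then have "C \<inter> {..j} \<subseteq> insert x (C - {y}) \<inter> {..j}" by auto
  then show ?thesis using assms(1) by (simp add: count_le_def card_mono)
qed

text \<open>Here \<open>D'\<close> is the next column after the insertion of \<open>y\<close>, and
  \<open>Z\<close> is the set of entries this bumps, empty or a singleton, so that both cases of
  \<open>column_insert\<close> are covered. The counts of \<open>D'\<close> exceed those of
  \<open>D\<close> only from \<open>y\<close> up to the first entry of \<open>D\<close> that is at
  least \<open>y\<close>, and there \<open>y \<in> C\<close> supplies the extra unit.\<close>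

lemma dominates_bump:
  assumes fin: "finite C" "finite D" and CD: "dominates C D"
    and y: "y \<in> C" "0 < y" "x \<le> y" "\<forall>z\<in>C. z < y \<longrightarrow> z < x"
    and D': "D' = insert y (D - Z)" "Z \<subseteq> D" "Z \<subseteq> {z}" "Z \<subseteq> {y..}" "\<forall>v\<in>D. y \<le> v \<longrightarrow> Z = {z} \<and> z \<le> v"
  shows "dominates (insert x (C - {y})) D'"
  unfolding dominates_def
proof
  fix j
  have "count_le D' j \<le> count_le C j"
  proof (cases "y \<le> j \<and> (\<forall>v\<in>D. y \<le> v \<longrightarrow> j < v)")
    case True
    have "D' \<inter> {..j} \<subseteq> insert y (D \<inter> {..y - 1})" using True y D' by fastforce
    then have "count_le D' j \<le> card (insert y (D \<inter> {..y - 1}))"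
      unfolding count_le_def using fin by (intro card_mono) auto
    also have "\<dots> \<le> Suc (count_le D (y - 1))" by (simp add: count_le_def card_insert_le_m1 card_insert_if fin)
    also have "\<dots> \<le> Suc (count_le C (y - 1))" using CD by (simp add: dominates_def)
    also have "\<dots> = card (insert y (C \<inter> {..y - 1}))" using y fin by (subst card_insert_disjoint) (auto simp: count_le_def)
    also have "\<dots> \<le> count_le C j" unfolding count_le_def using True y fin by (intro card_mono) auto
    finally show ?thesis .
  next
    case False
    have "count_le D' j \<le> count_le D j"
    proof (cases "y \<le> j")
      case True
      then obtain v where "v \<in> D" "y \<le> v" "v \<le> j" using False by (auto simp: not_less)
      then have Z: "Z = {z}" "z \<le> j" "z \<in> D" using D' by auto
      have "D' \<inter> {..j} \<subseteq> insert y (D \<inter> {..j} - {z})" using D' Z by auto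
      then have "count_le D' j \<le> card (insert y (D \<inter> {..j} - {z}))"
        unfolding count_le_def using fin by (intro card_mono) auto
      also have "\<dots> \<le> Suc (card (D \<inter> {..j} - {z}))" using fin by (simp add: card_insert_if)
      also have "\<dots> = count_le D j" unfolding count_le_def using Z fin by (intro card_Suc_Diff1) auto
      finally show ?thesis .
    next
      case False
      then have "D' \<inter> {..j} \<subseteq> D \<inter> {..j}" using D' by auto
      then show ?thesis unfolding count_le_def using fin by (intro card_mono) auto
    qed
    also have "\<dots> \<le> count_le C j" using CD by (simp add: dominates_def)
    finally show ?thesis .
  qed
  also have "\<dots> \<le> count_le (insert x (C - {y})) j" by (rule count_le_bump[OF fin(1) y(1,3,4)])
  finally show "count_le D' j \<le> count_le (insert x (C - {y})) j" .
qed

lemma tableau_column_insert: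
  assumes "tableau n cs" "x \<in> {1..n}"
  shows "tableau n (column_insert x cs)"
  using assms
proof (induction cs arbitrary: x)
  case Nil
  then show ?case by (simp add: tableau_def)
next
  case (Cons C cs)
  have C: "C \<subseteq> {1..n}" "C \<noteq> {}" and cs: "tableau n cs" and dom: "\<forall>D\<in>set cs. dominates C D"
    using Cons.prems(1) by (auto simp: tableau_def)
  have fin: "finite C" using C finite_subset by blast
  show ?case
  proof (cases "\<forall>z\<in>C. z < x")
    case True
    have "dominates (insert x C) C"
      unfolding dominates_def count_le_def using fin by (auto intro!: card_mono)
    then have "\<forall>D\<in>set cs. dominates (insert x C) D" using dom dominates_trans by blast
    then show ?thesis using True C cs Cons.prems(2) by (simp add: tableau_def)
  next
    case False
    define y where "y = Min {z \<in> C. x \<le> z}"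
    have y: "y \<in> C" "x \<le> y" "\<forall>z\<in>C. z < y \<longrightarrow> z < x"
      using least_above[OF fin False] by (auto simp: y_def)
    have y1: "y \<in> {1..n}" "0 < y" using y C by auto
    define C' where "C' = insert x (C - {y})"
    have C': "C' \<noteq> {}" "C' \<subseteq> {1..n}" using C Cons.prems(2) by (auto simp: C'_def)
    have IH: "tableau n (column_insert y cs)" by (rule Cons.IH[OF cs y1(1)])
    have ins: "column_insert x (C # cs) = C' # column_insert y cs"
      unfolding y_def C'_def using False by (simp only: column_insert.simps if_False Let_def)
    show ?thesis
    proof (cases cs)
      case Nil
      have "dominates C' {y}"
        using dominates_bump[OF fin, of "{}" y x "{y}" "{}" y] y y1 by (simp add: C'_def dominates_def count_le_def)
      then show ?thesis using IH C' ins Nil by (simp add: tableau_Cons2)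
    next
      case D: (Cons D ds)
      have DC: "dominates C D" "finite D"
        using dom D cs finite_subset[of D "{1..n}"] by (auto simp: tableau_def)
      obtain D' ds' where D': "column_insert y cs = D' # ds'" "dominates C' D'"
      proof (cases "\<forall>z\<in>D. z < y")
        case True
        then have "dominates C' (insert y D)"
          using dominates_bump[OF fin DC(2,1) y(1) y1(2) y(2,3), of "insert y D" "{}" y] by (fastforce simp: C'_def)
        then show ?thesis using that True D by simp
      next
        case False
        have "dominates C' (insert y (D - {Min {z \<in> D. y \<le> z}}))"
          using least_above[OF DC(2) False]
            dominates_bump[OF fin DC(2,1) y(1) y1(2) y(2,3) HOL.refl, of "{Min {z \<in> D. y \<le> z}}" "Min {z \<in> D. y \<le> z}"]
          by (auto simp: C'_def not_less[symmetric])
        moreover have "column_insert y cs =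
            insert y (D - {Min {z \<in> D. y \<le> z}}) # column_insert (Min {z \<in> D. y \<le> z}) ds"
          unfolding D using False by (simp only: column_insert.simps if_False Let_def)
        ultimately show ?thesis using that by blast
      qed
      then show ?thesis using IH C' ins by (simp add: tableau_Cons2)
    qed
  qed
qed

lemma set_tableau_word:
  assumes "tableau n cs"
  shows "set (tableau_word cs) \<subseteq> {1..n}"
proof -
  have "set (column_word C) \<subseteq> {1..n}" if "C \<in> set cs" for C
  proof -
    have "C \<subseteq> {1..n}" using assms that by (simp add: tableau_def)
    then show ?thesis using finite_subset[of C "{1..n}"] by (simp add: set_column_word)
  qed
  then show ?thesis by (simp add: tableau_word_def UN_subset_iff)
qed

lemma plactic_column_insert:
  assumes "tableau n cs" "x \<in> {1..n}"
  shows "(x # tableau_word cs, tableau_word (column_insert x cs)) \<in> plactic n"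
  using assms
proof (induction cs arbitrary: x)
  case Nil
  then show ?case by (auto simp: tableau_word_def column_word_def intro!: pres_cong.refl)
next
  case (Cons C cs)
  have C: "C \<subseteq> {1..n}" and cs: "tableau n cs"
    using Cons.prems(1) by (auto simp: tableau_def)
  have fin: "finite C" using C finite_subset by blast
  note set_word = set_tableau_word[OF cs]
  show ?case
  proof (cases "\<forall>z\<in>C. z < x")
    case True
    then have "column_word (insert x C) = x # column_word C"
      using column_word_unique[of "x # column_word C"] sorted_column_word[of C]
      by (simp add: set_column_word fin)
    then have "tableau_word (column_insert x (C # cs)) = x # tableau_word (C # cs)"
      using True by (simp add: tableau_word_def)
    moreover have "x # tableau_word (C # cs) \<in> lists {1..n}"
      using set_tableau_word[OF Cons.prems(1)] Cons.prems(2) by auto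
    ultimately show ?thesis by (simp only: pres_cong.refl)
  next
    case False
    define y where "y = Min {z \<in> C. x \<le> z}"
    have y: "y \<in> C" "x \<le> y" "\<And>z. z \<in> C \<Longrightarrow> z < y \<Longrightarrow> z < x"
      using least_above[OF fin False] by (auto simp: y_def)
    \<comment> \<open>The column word is \<open>A @ y # B\<close>. Entries below \<open>y\<close>
      are below \<open>x\<close>, so \<open>A @ x # B\<close> is again decreasing and is the word of
      the new column.\<close>
    define A where "A = column_word (C \<inter> {y<..})"
    define B where "B = column_word (C \<inter> {..<y})"
    have AB: "set A = C \<inter> {y<..}" "set B = C \<inter> {..<y}" "sorted_wrt (>) A" "sorted_wrt (>) B"
      by (simp_all add: A_def B_def set_column_word sorted_column_word fin)
    have dec: "sorted_wrt (>) (A @ y # B)" using AB by (auto simp: sorted_wrt_append)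
    have "C \<inter> {y<..} \<union> insert y (C \<inter> {..<y}) = C"
      using y(1) by (auto intro: linorder_neqE_nat)
    then have setC: "set (A @ y # B) = C" by (simp only: set_append list.set AB(1,2))
    from column_word_unique[OF dec] have wC: "column_word C = A @ y # B" unfolding setC .
    have dec': "sorted_wrt (>) (A @ x # B)"
      using AB y(2) y(3) by (fastforce simp: sorted_wrt_append)
    have "C \<inter> {y<..} \<union> insert x (C \<inter> {..<y}) = insert x (C - {y})"
      by (auto intro: linorder_neqE_nat)
    then have setC': "set (A @ x # B) = insert x (C - {y})" by (simp only: set_append list.set AB(1,2))
    from column_word_unique[OF dec'] have wC': "column_word (insert x (C - {y})) = A @ x # B"
      unfolding setC' .
    have letters: "set A \<union> set B \<union> {x, y} \<subseteq> {1..n}"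
      using AB(1,2) y(1) C Cons.prems(2) by blast
    have "(x # A @ y # B, A @ x # B @ [y]) \<in> plactic n"
    proof (rule plactic_bump)
      show "\<forall>b\<in>set B. b < x" using AB(2) y(3) by simp
    qed (use letters y(2) dec in simp_all)
    then have 1: "((x # A @ y # B) @ tableau_word cs, (A @ x # B @ [y]) @ tableau_word cs) \<in> plactic n"
      using set_word by (rule plactic_right)
    have "(y # tableau_word cs, tableau_word (column_insert y cs)) \<in> plactic n"
      using cs letters by (intro Cons.IH) simp_all
    then have 2: "((A @ x # B) @ (y # tableau_word cs), (A @ x # B) @ tableau_word (column_insert y cs)) \<in> plactic n"
      by (rule plactic_left) (use letters in simp)
    have "column_insert x (C # cs) = insert x (C - {y}) # column_insert y cs"
      unfolding y_def using False by (simp only: column_insert.simps if_False Let_def)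
    then have "tableau_word (column_insert x (C # cs)) = (A @ x # B) @ tableau_word (column_insert y cs)"
      by (simp add: tableau_word_def wC')
    moreover have "x # tableau_word (C # cs) = (x # A @ y # B) @ tableau_word cs"
      by (simp add: tableau_word_def wC)
    moreover have "(A @ x # B) @ (y # tableau_word cs) = (A @ x # B @ [y]) @ tableau_word cs" by simp
    ultimately show ?thesis using pres_cong.trans[OF 1] 2 by (simp only:)
  qed
qed

lemma plactic_tableau_exists:
  assumes "set u \<subseteq> {1..n}"
  shows "\<exists>cs. tableau n cs \<and> (u, tableau_word cs) \<in> plactic n"
  using assms
proof (induction u)
  case Nil
  then show ?case
    by (intro exI[of _ "[]"]) (auto simp: tableau_def tableau_word_def intro!: pres_cong.refl)
next
  case (Cons x u)
  then obtain cs where cs: "tableau n cs" "(u, tableau_word cs) \<in> plactic n" by auto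
  have x: "x \<in> {1..n}" using Cons.prems by simp
  have "([x] @ u, [x] @ tableau_word cs) \<in> plactic n" using cs(2) x by (intro plactic_left) auto
  then have "(x # u, tableau_word (column_insert x cs)) \<in> plactic n"
    using pres_cong.trans[OF _ plactic_column_insert[OF cs(1) x]] by simp
  then show ?case using tableau_column_insert[OF cs(1) x] by blast
qed

section \<open>Tropical entries of tableaux\<close>

definition low :: "nat \<Rightarrow> nat list" where
  "low m = [1..<Suc m]"

definition high :: "nat \<Rightarrow> nat \<Rightarrow> nat list" where
  "high m j = [Suc (j - m)..<Suc j]"

lemma box_low_high:
  assumes "m \<le> j"
  shows "box (low m) (high m j) x i \<longleftrightarrow> i < m \<and> i < x \<and> x \<le> Suc (j - m + i)"
  using assms by (auto simp: low_def high_def box_def simp del: upt_Suc)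

lemma low_high_states:
  assumes "m \<le> j"
  shows "sorted_wrt (<) (low m)" "sorted_wrt (<) (high m j)" "list_all2 (\<le>) (low m) (high m j)"
  using assms by (auto simp: low_def high_def list_all2_conv_all_nth simp del: upt_Suc)

lemma coloured_append:
  "coloured P Q (y @ z) \<longleftrightarrow> coloured P Q y \<and> coloured P Q z \<and> (\<forall>p\<in>set y. \<forall>q\<in>set z. rising p q)"
  by (auto simp: coloured_def sorted_wrt_append)

lemma distinct_if_decreasing: "sorted_wrt (>) xs \<Longrightarrow> distinct (xs :: nat list)"
  by (induction xs) auto

lemma colours_decreasing:
  "sorted_wrt rising z \<Longrightarrow> sorted_wrt (>) (map fst z) \<Longrightarrow> sorted_wrt (>) (map snd z)"
  by (induction z) (fastforce simp: rising_def)+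

text \<open>By \<open>rising\<close>, a smaller letter that comes later has a smaller colour. So the
  letters picked from one column have distinct colours below \<open>m\<close>, and they are distinct
  entries up to \<open>j\<close>.\<close>

lemma coloured_column_le:
  assumes "m \<le> j" "coloured (low m) (high m j) z" "subseq (map fst z) (column_word C)" "finite C"
  shows "length z \<le> min m (count_le C j)"
proof -
  have dec: "sorted_wrt (>) (map fst z)" by (rule sorted_wrt_subseq[OF assms(3) sorted_column_word])
  have box: "snd p < m \<and> fst p \<le> j" if "p \<in> set z" for p
  proof -
    have "box (low m) (high m j) (fst p) (snd p)" using assms(2) that by (simp add: coloured_def)
    then show ?thesis using assms(1) by (auto simp: box_low_high)
  qed
  have "set (map fst z) \<subseteq> C"
    using list_emb_set[OF assms(3)] set_column_word[OF assms(4)] by blast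
  then have "set (map fst z) \<subseteq> C \<inter> {..j}" using box by auto
  then have "card (set (map fst z)) \<le> count_le C j"
    unfolding count_le_def using assms(4) by (intro card_mono) auto
  then have C: "length z \<le> count_le C j"
    using distinct_card[OF distinct_if_decreasing[OF dec]] by simp
  have "sorted_wrt (>) (map snd z)" using assms(2) dec by (intro colours_decreasing) (auto simp: coloured_def)
  from distinct_card[OF distinct_if_decreasing[OF this]]
  have "length (map snd z) = card (set (map snd z))" by (rule HOL.sym)
  also have "\<dots> \<le> card {..<m}" using box by (intro card_mono) auto
  finally show ?thesis using C by simp
qed

lemma coloured_tableau_le:
  assumes "m \<le> j" "coloured (low m) (high m j) z" "subseq (map fst z) (tableau_word cs)" "\<forall>C\<in>set cs. finite C"
  shows "length z \<le> (\<Sum>C\<leftarrow>cs. min m (count_le C j))"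
  using assms(2-)
proof (induction cs arbitrary: z)
  case Nil
  then show ?case using list_emb_Nil2 by (fastforce simp: tableau_word_def)
next
  case (Cons C cs)
  then obtain p q where pq: "map fst z = p @ q" "subseq p (column_word C)" "subseq q (tableau_word cs)"
    by (auto simp: subseq_append_iff tableau_word_def)
  from pq(1) obtain x y where xy: "z = x @ y" "p = map fst x" "q = map fst y"
    by (auto simp: map_eq_append_conv)
  have c: "coloured (low m) (high m j) x" "coloured (low m) (high m j) y"
    using Cons.prems(1) xy(1) by (auto simp: coloured_def sorted_wrt_append)
  have 1: "length x \<le> min m (count_le C j)"
    by (rule coloured_column_le[OF assms(1) c(1)]) (use pq xy Cons.prems in auto)
  have "length y \<le> (\<Sum>C\<leftarrow>cs. min m (count_le C j))"
    using pq xy Cons.prems by (intro Cons.IH[OF c(2)]) auto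
  from add_mono[OF 1 this] show ?case using xy(1) by simp
qed

section \<open>Ranks in a column and an optimal colouring\<close>

lemma count_le_strict_mono:
  assumes "finite C" "y \<in> C" "x < y"
  shows "count_le C x < count_le C y"
proof -
  have "C \<inter> {..x} \<subseteq> C \<inter> {..y}" "y \<in> C \<inter> {..y}" "y \<notin> C \<inter> {..x}" using assms by auto
  then have "C \<inter> {..x} \<subset> C \<inter> {..y}" by blast
  then show ?thesis unfolding count_le_def using assms(1) by (intro psubset_card_mono) auto
qed

lemma count_le_mono: "finite C \<Longrightarrow> x \<le> y \<Longrightarrow> count_le C x \<le> count_le C y"
  unfolding count_le_def by (intro card_mono) auto

lemma count_le_diff:
  assumes "finite C" "x \<le> y"
  shows "count_le C y \<le> count_le C x + (y - x)"
proof -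
  have "count_le C y \<le> card ((C \<inter> {..x}) \<union> {x<..y})"
    unfolding count_le_def using assms by (intro card_mono) auto
  also have "\<dots> \<le> count_le C x + card {x<..y}"
    unfolding count_le_def by (rule card_Un_le)
  finally show ?thesis by simp
qed

lemma count_le_le:
  assumes "C \<subseteq> {1..n}"
  shows "count_le C j \<le> j"
proof -
  have "count_le C j \<le> card {1..j}"
    unfolding count_le_def using assms by (intro card_mono) auto
  then show ?thesis by simp
qed

lemma count_le_pos:
  assumes "finite C" "x \<in> C"
  shows "0 < count_le C x"
  using assms by (auto simp: count_le_def card_gt_0_iff)

text \<open>\<open>count_le C x\<close> is the rank of an entry \<open>x\<close>, so it maps the
  entries up to \<open>j\<close> bijectively onto \<open>{1..count_le C j}\<close>.\<close>

lemma card_low_ranks: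
  assumes "finite C"
  shows "card {x \<in> C. x \<le> j \<and> count_le C x \<le> m} = min m (count_le C j)"
proof -
  let ?A = "C \<inter> {..j}" and ?N = "count_le C j"
  have inj: "inj_on (count_le C) C"
    using count_le_strict_mono[OF assms] by (intro linorder_inj_onI') fastforce
  have sub: "count_le C ` ?A \<subseteq> {1..?N}"
    using count_le_pos[OF assms] count_le_mono[OF assms] by (auto simp: Suc_le_eq)
  have "card (count_le C ` ?A) = ?N"
    using inj by (subst card_image) (auto simp: count_le_def intro: inj_on_subset)
  then have im: "count_le C ` ?A = {1..?N}" using card_subset_eq[OF _ sub] by simp
  have "count_le C ` {x \<in> C. x \<le> j \<and> count_le C x \<le> m} = count_le C ` ?A \<inter> {..m}" by auto
  also have "\<dots> = {1..min m ?N}" unfolding im by auto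
  finally have "card (count_le C ` {x \<in> C. x \<le> j \<and> count_le C x \<le> m}) = min m ?N" by simp
  then show ?thesis using inj by (subst (asm) card_image) (auto intro: inj_on_subset)
qed

text \<open>The entry \<open>x\<close> of a column \<open>C\<close> would naturally get the index of its row as colour; the
  second argument of the maximum is the least colour that \<^term>\<open>high m j\<close> allows for \<open>x\<close>.\<close>

definition row_colour :: "nat \<Rightarrow> nat \<Rightarrow> nat set \<Rightarrow> nat \<Rightarrow> nat" where
  "row_colour m j C x = max (count_le C x) (x - (j - m)) - 1"

definition column_colouring :: "nat \<Rightarrow> nat \<Rightarrow> nat set \<Rightarrow> (nat \<times> nat) list" where
  "column_colouring m j C =
     map (\<lambda>x. (x, row_colour m j C x)) (filter (\<lambda>x. x \<le> j \<and> count_le C x \<le> m) (column_word C))"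

lemma length_column_colouring:
  assumes "finite C"
  shows "length (column_colouring m j C) = min m (count_le C j)"
proof -
  have "length (column_colouring m j C) = card ({x. x \<le> j \<and> count_le C x \<le> m} \<inter> C)"
    unfolding column_colouring_def length_map
    by (subst distinct_length_filter) (simp_all add: column_word_def assms)
  also have "{x. x \<le> j \<and> count_le C x \<le> m} \<inter> C = {x \<in> C. x \<le> j \<and> count_le C x \<le> m}" by blast
  finally show ?thesis using card_low_ranks[OF assms] by simp
qed

lemma coloured_column_colouring:
  assumes "m \<le> j" "C \<subseteq> {1..n}"
  shows "coloured (low m) (high m j) (column_colouring m j C)"
  unfolding coloured_def
proof
  have fin: "finite C" using assms(2) finite_subset by blast
  have r: "rising (x, row_colour m j C x) (y, row_colour m j C y)" if "x \<in> C" "y \<in> C" "y < x" for x y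
    using count_le_strict_mono[OF fin that(1,3)] count_le_pos[OF fin that(2)] that(3)
    by (auto simp: rising_def row_colour_def max_def)
  have set: "set (filter (\<lambda>x. x \<le> j \<and> count_le C x \<le> m) (column_word C)) \<subseteq> C"
    using set_column_word[OF fin] by auto
  have "sorted_wrt (>) (filter (\<lambda>x. x \<le> j \<and> count_le C x \<le> m) (column_word C))"
    by (intro sorted_wrt_filter sorted_column_word)
  then show "sorted_wrt rising (column_colouring m j C)"
    unfolding column_colouring_def sorted_wrt_map
    by (rule sorted_wrt_mono_rel[rotated]) (use r set in blast)
  show "\<forall>p\<in>set (column_colouring m j C). box (low m) (high m j) (fst p) (snd p)"
  proof
    fix p assume "p \<in> set (column_colouring m j C)"
    then obtain x where x: "p = (x, row_colour m j C x)" "x \<in> C" "x \<le> j" "count_le C x \<le> m"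
      using set_column_word[OF fin] by (auto simp: column_colouring_def)
    have "0 < count_le C x" "count_le C x \<le> x"
      using count_le_pos[OF fin x(2)] count_le_le[OF assms(2)] by auto
    then show "box (low m) (high m j) (fst p) (snd p)"
      using x assms(1) by (auto simp: box_low_high row_colour_def max_def)
  qed
qed

text \<open>Domination gives \<open>count_le D y \<le> count_le C y\<close>. For
  \<open>y < x\<close> the colour therefore drops; otherwise the counts of \<open>C\<close>, and
  with them the colour, rise by at most \<open>y - x\<close>.\<close>

lemma rising_between_columns:
  assumes "finite C" "dominates C D" "p \<in> set (column_colouring m j C)" "q \<in> set (column_colouring m j D)"
    "finite D"
  shows "rising p q"
proof -
  obtain x y where x: "p = (x, row_colour m j C x)" "x \<in> C" and y: "q = (y, row_colour m j D y)" "y \<in> D"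
    using assms by (auto simp: column_colouring_def set_column_word)
  have le: "count_le D y \<le> count_le C y" using assms(2) by (simp add: dominates_def)
  have pos: "0 < count_le C x" "0 < count_le D y"
    using assms x y by (auto intro: count_le_pos)
  show ?thesis
  proof (cases "y < x")
    case True
    then have "count_le D y < count_le C x" using count_le_strict_mono[OF assms(1) x(2) True] le by simp
    then show ?thesis using x y pos True by (auto simp: rising_def row_colour_def max_def)
  next
    case False
    then have "count_le D y \<le> count_le C x + (y - x)" using count_le_diff[OF assms(1), of x y] le by simp
    then show ?thesis using x y pos False by (auto simp: rising_def row_colour_def max_def)
  qed
qed

text \<open>A single column contributes at most \<open>min m (count_le C j)\<close> letters, and
  \<open>column_colouring\<close> attains this for all columns at once, since by domination the
  colours of different columns are compatible.\<close>

lemma ach_tableau: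
  assumes "tableau n cs" "m \<le> j"
  shows "ach (low m) (high m j) (tableau_word cs) c \<longleftrightarrow> c \<le> (\<Sum>C\<leftarrow>cs. min m (count_le C j))"
proof
  have fin: "\<forall>C\<in>set cs. finite C"
    using assms(1) finite_subset[of _ "{1..n}"] by (auto simp: tableau_def)
  {
    assume "ach (low m) (high m j) (tableau_word cs) c"
    then obtain z where z: "coloured (low m) (high m j) z" "subseq (map fst z) (tableau_word cs)" "c \<le> length z"
      unfolding ach_def by (elim exE conjE)
    from coloured_tableau_le[OF assms(2) z(1,2) fin] z(3)
    show "c \<le> (\<Sum>C\<leftarrow>cs. min m (count_le C j))" by simp
  }
  {
    assume c: "c \<le> (\<Sum>C\<leftarrow>cs. min m (count_le C j))"
    let ?z = "\<lambda>cs. concat (map (column_colouring m j) cs)"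
    have "coloured (low m) (high m j) (?z cs) \<and> subseq (map fst (?z cs)) (tableau_word cs)
        \<and> length (?z cs) = (\<Sum>C\<leftarrow>cs. min m (count_le C j))"
      using assms(1) fin
    proof (induction cs)
      case Nil
      then show ?case by (simp add: coloured_Nil tableau_word_def)
    next
      case (Cons C cs)
      then have t: "tableau n cs" and C: "C \<subseteq> {1..n}" "finite C" and dom: "\<forall>D\<in>set cs. dominates C D"
        by (auto simp: tableau_def)
      have fin: "\<forall>D\<in>set cs. finite D" using Cons.prems(2) by simp
      note IH = Cons.IH[OF t fin]
      note cC = coloured_column_colouring[OF assms(2) C(1)]
      have "rising p q" if "p \<in> set (column_colouring m j C)" "q \<in> set (?z cs)" for p q
      proof -
        from that(2) obtain D where D: "D \<in> set cs" "q \<in> set (column_colouring m j D)" by auto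
        then have "dominates C D" "finite D" using dom fin by simp_all
        from rising_between_columns[OF C(2) this(1) that(1) D(2) this(2)] show ?thesis .
      qed
      then have "coloured (low m) (high m j) (?z (C # cs))"
        using IH cC by (simp add: coloured_append del: set_concat)
      moreover have "subseq (map fst (column_colouring m j C)) (column_word C)"
        by (simp add: column_colouring_def comp_def)
      then have "subseq (map fst (?z (C # cs))) (tableau_word (C # cs))"
        using IH by (simp add: tableau_word_def list_emb_append_mono)
      moreover have "length (?z (C # cs)) = (\<Sum>D\<leftarrow>C # cs. min m (count_le D j))"
        using IH length_column_colouring[OF C(2)] by simp
      ultimately show ?case by blast
    qed
    then show "ach (low m) (high m j) (tableau_word cs) c"
      unfolding ach_def using low_high_states[OF assms(2)] c by (intro conjI exI[of _ "?z cs"]) simp_all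
  }
qed

section \<open>Recovering a tableau from truncated column counts\<close>

lemma sum_min_Suc:
  "(\<Sum>x\<leftarrow>xs. min (Suc m) x) = (\<Sum>x\<leftarrow>xs. min m x) + length (filter (\<lambda>x. m < x) xs)"
  by (induction xs) auto

lemma count_mset_filter:
  fixes xs :: "nat list"
  shows "count (mset xs) m + length (filter (\<lambda>x. m < x) xs) = length (filter (\<lambda>x. m \<le> x) xs)"
  by (induction xs) auto

text \<open>Differences of the truncated sums count the terms exceeding \<open>m\<close>, and
  differences of these counts are the multiplicities; the common length supplies the count at
  0.\<close>

lemma mset_eq_sum_min:
  fixes xs ys :: "nat list"
  assumes "length xs = length ys" "\<And>m. (\<Sum>x\<leftarrow>xs. min m x) = (\<Sum>y\<leftarrow>ys. min m y)"
  shows "mset xs = mset ys"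
proof (rule multiset_eqI)
  have gr: "length (filter (\<lambda>x. m < x) xs) = length (filter (\<lambda>x. m < x) ys)" for m
    using sum_min_Suc[of m xs] sum_min_Suc[of m ys] assms(2) by simp
  have ge: "length (filter (\<lambda>x. m \<le> x) xs) = length (filter (\<lambda>x. m \<le> x) ys)" for m
    by (cases m) (use gr assms(1) in \<open>simp_all add: Suc_le_eq\<close>)
  show "count (mset xs) m = count (mset ys) m" for m
    using count_mset_filter[of xs m] count_mset_filter[of ys m] gr[of m] ge[of m] by simp
qed

lemma count_le_inject:
  assumes "finite C" "finite D" "count_le C = count_le D"
  shows "C = D"
proof -
  have mem: "x \<in> C \<longleftrightarrow> (if x = 0 then count_le C 0 \<noteq> 0 else count_le C x \<noteq> count_le C (x - 1))"
    if "finite C" for C x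
  proof (cases "x = 0")
    case False
    have "{..x} = insert x {..x - 1}" using False by auto
    then show ?thesis using False that by (auto simp: count_le_def Int_insert_right)
  qed (use that in \<open>auto simp: count_le_def\<close>)
  show ?thesis using mem[OF assms(1)] mem[OF assms(2)] assms(3) by auto
qed

text \<open>For fixed \<open>j\<close>, the sums determine the multiset of the numbers
  \<open>count_le C j\<close>. Domination makes these weakly decreasing along the tableau, which
  fixes their order, and a column is recovered from its counting function.\<close>

lemma tableau_unique:
  assumes cs: "tableau n cs" and ds: "tableau n ds"
    and eq: "\<And>m j. m \<le> j \<Longrightarrow> j \<le> n \<Longrightarrow>
      (\<Sum>C\<leftarrow>cs. min m (count_le C j)) = (\<Sum>C\<leftarrow>ds. min m (count_le C j))"
  shows "cs = ds"
proof -
  have sub: "\<forall>C\<in>set cs \<union> set ds. C \<subseteq> {1..n} \<and> finite C \<and> C \<noteq> {}"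
    using cs ds finite_subset[of _ "{1..n}"] by (auto simp: tableau_def)
  \<comment> \<open>Entries are at most \<open>n\<close> and \<open>count_le C j \<le> j\<close>, so
    the hypothesis for \<open>m \<le> j \<le> n\<close> yields the equality for all \<open>m\<close>
    and \<open>j\<close>.\<close>
  have truncate: "min m (count_le C j) = min (min m (min j n)) (count_le C (min j n))" if "C \<subseteq> {1..n}" for C m j
  proof -
    have "C \<inter> {..j} = C \<inter> {..min j n}" using that by auto
    then have "count_le C j = count_le C (min j n)" by (simp add: count_le_def)
    then show ?thesis using count_le_le[OF that, of "min j n"] by (simp add: min_def)
  qed
  have all: "(\<Sum>C\<leftarrow>cs. min m (count_le C j)) = (\<Sum>C\<leftarrow>ds. min m (count_le C j))" for m j
  proof -
    have "(\<Sum>C\<leftarrow>es. min m (count_le C j)) = (\<Sum>C\<leftarrow>es. min (min m (min j n)) (count_le C (min j n)))"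
      if "set es \<subseteq> set cs \<union> set ds" for es
    proof -
      have "min m (count_le C j) = min (min m (min j n)) (count_le C (min j n))" if "C \<in> set es" for C
        by (rule truncate) (use sub that \<open>set es \<subseteq> set cs \<union> set ds\<close> in blast)
      then show ?thesis by (intro arg_cong[of _ _ sum_list] map_cong HOL.refl)
    qed
    note truncated = this
    have "min m (min j n) \<le> min j n" "min j n \<le> n" by (rule min.cobounded2)+
    from eq[OF this] show ?thesis using truncated[of cs] truncated[of ds] by simp
  qed
  \<comment> \<open>Columns are nonempty, so for \<open>m = 1\<close> and \<open>j = n\<close> the
    sum is the number of columns.\<close>
  have len: "length cs = length ds"
  proof -
    have "(\<Sum>C\<leftarrow>es. min 1 (count_le C n)) = length es" if es: "set es \<subseteq> set cs \<union> set ds" for es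
    proof -
      have "min 1 (count_le C n) = 1" if "C \<in> set es" for C
      proof -
        have C: "C \<subseteq> {1..n}" "finite C" "C \<noteq> {}" using sub es that by blast+
        from C(3) obtain x where x: "x \<in> C" by blast
        then have "x \<le> n" using C(1) by auto
        have "0 < count_le C n"
          using count_le_pos[OF C(2) x] count_le_mono[OF C(2) \<open>x \<le> n\<close>] by simp
        then show ?thesis by simp
      qed
      then have "map (\<lambda>C. min 1 (count_le C n)) es = map (\<lambda>C. 1) es" by (intro map_cong HOL.refl)
      then have "(\<Sum>C\<leftarrow>es. min 1 (count_le C n)) = (\<Sum>C\<leftarrow>es. 1)" by (simp only:)
      then show ?thesis by (simp add: sum_list_triv)
    qed
    from this[of cs] this[of ds] show ?thesis using all[of 1 n] by simp
  qed
  have "map (\<lambda>C. count_le C j) cs = map (\<lambda>C. count_le C j) ds" for j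
  proof -
    have mset: "mset (map (\<lambda>C. count_le C j) cs) = mset (map (\<lambda>C. count_le C j) ds)"
      by (rule mset_eq_sum_min) (simp_all only: length_map len map_map comp_def all)
    have sorted: "sorted (rev (map (\<lambda>C. count_le C j) es))" if "tableau n es" for es
    proof -
      have "sorted_wrt (\<lambda>C D. count_le D j \<le> count_le C j) es"
        by (rule sorted_wrt_mono_rel[of _ dominates])
          (use that in \<open>simp_all add: tableau_def dominates_def\<close>)
      then show ?thesis by (simp add: sorted_wrt_rev sorted_wrt_map)
    qed
    have 1: "sort (map (\<lambda>C. count_le C j) cs) = rev (map (\<lambda>C. count_le C j) cs)"
      by (rule properties_for_sort[OF _ sorted[OF cs]]) simp
    have 2: "sort (map (\<lambda>C. count_le C j) cs) = rev (map (\<lambda>C. count_le C j) ds)"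
      by (rule properties_for_sort[OF _ sorted[OF ds]]) (simp only: mset_rev mset)
    from HOL.trans[OF HOL.sym[OF 1] 2] show ?thesis by (rule rev_is_rev_conv[THEN iffD1])
  qed
  then have maps: "map (\<lambda>C. count_le C j) cs ! i = map (\<lambda>C. count_le C j) ds ! i" for i j
    by (rule arg_cong)
  have count: "count_le (cs ! i) = count_le (ds ! i)" if "i < length cs" for i
  proof
    show "count_le (cs ! i) j = count_le (ds ! i) j" for j
      using maps[of j i] that len by simp
  qed
  show ?thesis
  proof (rule nth_equalityI[OF len])
    fix i assume i: "i < length cs"
    then have "finite (cs ! i)" "finite (ds ! i)" using sub len by simp_all
    then show "cs ! i = ds ! i" using count[OF i] by (rule count_le_inject)
  qed
qed

lemma plactic_if_ach_eq:
  assumes "set u \<subseteq> {1..n}" "set v \<subseteq> {1..n}"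
    and "\<And>m j c. m \<le> j \<Longrightarrow> j \<le> n \<Longrightarrow> ach (low m) (high m j) u c \<longleftrightarrow> ach (low m) (high m j) v c"
  shows "(u, v) \<in> plactic n"
proof -
  obtain cs where cs: "tableau n cs" "(u, tableau_word cs) \<in> plactic n"
    using plactic_tableau_exists[OF assms(1)] by blast
  obtain ds where ds: "tableau n ds" "(v, tableau_word ds) \<in> plactic n"
    using plactic_tableau_exists[OF assms(2)] by blast
  have "cs = ds"
  proof (rule tableau_unique[OF cs(1) ds(1)])
    fix m j assume mj: "m \<le> j" "j \<le> n"
    have "c \<le> (\<Sum>C\<leftarrow>cs. min m (count_le C j)) \<longleftrightarrow> c \<le> (\<Sum>C\<leftarrow>ds. min m (count_le C j))" for c
      unfolding ach_tableau[OF cs(1) mj(1), symmetric] ach_tableau[OF ds(1) mj(1), symmetric]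
        ach_knuth[OF cs(2), symmetric] ach_knuth[OF ds(2), symmetric]
      by (rule assms(3)[OF mj])
    then show "(\<Sum>C\<leftarrow>cs. min m (count_le C j)) = (\<Sum>C\<leftarrow>ds. min m (count_le C j))"
      using le_antisym by blast
  qed
  then show ?thesis using pres_cong.trans[OF cs(2)] pres_cong.sym[OF ds(2)] by simp
qed

section \<open>The identity in the plactic monoid\<close>

definition block :: "'a list \<Rightarrow> 'a list \<Rightarrow> bool \<Rightarrow> 'a list" where
  "block A B b = (if b then A @ B else B @ A)"

lemma set_block: "set (block A B b) = set A \<union> set B"
  by (auto simp: block_def)

text \<open>The empty word is excluded: \<open>ach P Q [] 0\<close> holds for any states with
  \<open>P\<close> entrywise at most \<open>Q\<close>, whereas a run over \<open>[]\<close> stays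
  where it is.\<close>

lemma ach_concat:
  assumes "bs \<noteq> []"
  shows "ach P Q (concat (map f bs)) c \<longleftrightarrow> run (\<lambda>x P Q c. ach P Q (f x) c) P bs Q c"
  using assms
proof (induction bs arbitrary: P c rule: list_nonempty_induct)
  case (single x)
  then show ?case using ach_mono by auto
next
  case (cons x xs)
  then show ?case by (simp add: ach_append)
qed

lemma sum_list_less_if_le:
  assumes "list_all2 (\<le>) P (Q :: nat list)" "P \<noteq> Q"
  shows "sum_list P < sum_list Q"
proof -
  have "sum_list P \<le> sum_list Q \<and> (P \<noteq> Q \<longrightarrow> sum_list P < sum_list Q)"
    using assms(1) by induction auto
  then show ?thesis using assms(2) by simp
qed

text \<open>The sum of the components serves as rank. Each of the \<open>m\<close> components rises
  by \<open>j - m\<close>, and \<open>m * (j - m)\<close> is bounded by the inequality of arithmetic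
  and geometric means.\<close>

lemma sum_list_high:
  assumes "m \<le> j" "j \<le> n"
  shows "sum_list (high m j) \<le> sum_list (low m) + n\<^sup>2 div 4"
proof -
  define e where "e = j - m"
  have "high m j = map (\<lambda>i. i + e) (low m)"
    using assms by (intro nth_equalityI) (auto simp: low_def high_def e_def simp del: upt_Suc)
  then have "sum_list (high m j) = sum_list (low m) + m * e"
    by (simp add: sum_list_addf sum_list_triv low_def del: upt_Suc)
  moreover have "4 * (m * e) \<le> n\<^sup>2"
  proof -
    have "0 \<le> (int m - int e)\<^sup>2" by simp
    then have "int (4 * (m * e)) \<le> int ((m + e)\<^sup>2)" by (simp add: power2_eq_square algebra_simps)
    then have "4 * (m * e) \<le> (m + e)\<^sup>2" by (simp only: of_nat_le_iff)
    also have "\<dots> \<le> n\<^sup>2" using assms by (intro power_mono) (simp_all add: e_def)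
    finally show ?thesis .
  qed
  then have "m * e \<le> n\<^sup>2 div 4" by simp
  ultimately show ?thesis by simp
qed

lemma plactic_identity:
  assumes w: "\<And>s. length s = n\<^sup>2 div 4 \<Longrightarrow> \<exists>p q. w = p @ s @ q"
    and AB: "set A \<subseteq> {1..n}" "set B \<subseteq> {1..n}"
  shows "(concat (map (block A B) (w @ [True] @ w)), concat (map (block A B) (w @ [False] @ w))) \<in> plactic n"
proof (rule plactic_if_ach_eq)
  have letters: "set (concat (map (block A B) bs)) \<subseteq> {1..n}" for bs
    using AB by (auto simp: set_block)
  show "set (concat (map (block A B) (w @ [True] @ w))) \<subseteq> {1..n}" by (rule letters)
  show "set (concat (map (block A B) (w @ [False] @ w))) \<subseteq> {1..n}" by (rule letters)
  fix m j c assume mj: "m \<le> j" "j \<le> n"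
  let ?st = "\<lambda>x P Q c. ach P Q (block A B x) c"
  \<comment> \<open>\<open>A @ B\<close> and \<open>B @ A\<close> have the same letters, so by
    \<open>ach_diag\<close> staying weighs the same under both.\<close>
  interpret stay_runs ?st "sorted_wrt (<)" "\<lambda>P. length (filter (\<lambda>x. x \<in> set P) (A @ B))"
  proof
    show "sorted_wrt (<) P \<and> sorted_wrt (<) Q" if "ach P Q (block A B x) a" for P Q x a
      using that by (simp add: ach_def)
    show "ach P P (block A B x) a \<longleftrightarrow> a \<le> length (filter (\<lambda>x. x \<in> set P) (A @ B))"
      if "sorted_wrt (<) P" for P x a
      unfolding ach_diag[OF that] by (simp add: block_def add.commute)
  qed
  have rk: "\<forall>x P Q a. ach P Q (block A B x) a \<longrightarrow> P \<noteq> Q \<longrightarrow> sum_list P < sum_list Q"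
    using sum_list_less_if_le by (simp add: ach_def)
  have "run ?st (low m) (w @ [y] @ w) (high m j) c"
    if "run ?st (low m) (w @ [x] @ w) (high m j) c" for x y
    by (rule run_exchange_middle[OF rk w that sum_list_high[OF mj]])
  then show "ach (low m) (high m j) (concat (map (block A B) (w @ [True] @ w))) c \<longleftrightarrow>
      ach (low m) (high m j) (concat (map (block A B) (w @ [False] @ w))) c"
    by (subst (1 2) ach_concat) (simp, simp, blast)
qed

section \<open>Identities and varieties\<close>

definition eval_word :: "('a, 'b) monoid_scheme \<Rightarrow> ('x \<Rightarrow> 'a) \<Rightarrow> 'x list \<Rightarrow> 'a" where
  "eval_word M f u = foldr (\<lambda>x a. f x \<otimes>\<^bsub>M\<^esub> a) u \<one>\<^bsub>M\<^esub>"

definition satisfies :: "('a, 'b) monoid_scheme \<Rightarrow> 'x list \<Rightarrow> 'x list \<Rightarrow> bool" where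
  "satisfies M u v \<longleftrightarrow> (\<forall>f. range f \<subseteq> carrier M \<longrightarrow> eval_word M f u = eval_word M f v)"

lemma eval_word_simps:
  "eval_word M f [] = \<one>\<^bsub>M\<^esub>"
  "eval_word M f (x # u) = f x \<otimes>\<^bsub>M\<^esub> eval_word M f u"
  by (simp_all add: eval_word_def)

lemma eval_word_closed:
  assumes "monoid M" "range f \<subseteq> carrier M"
  shows "eval_word M f u \<in> carrier M"
  using assms by (induction u) (auto simp: eval_word_simps intro: monoid.one_closed monoid.m_closed)

text \<open>Membership in \<open>hom\<close> only gives multiplicativity; preservation of the unit
  is derived from a preimage of the unit of \<open>N\<close>.\<close>

lemma hom_one_if_surj:
  assumes "h \<in> hom M N" "h ` carrier M = carrier N" "monoid M" "monoid N"
  shows "h \<one>\<^bsub>M\<^esub> = \<one>\<^bsub>N\<^esub>"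
proof -
  interpret M: monoid M by fact
  interpret N: monoid N by fact
  obtain x where x: "x \<in> carrier M" "\<one>\<^bsub>N\<^esub> = h x" using assms(2) N.one_closed by (metis imageE)
  have "h \<one>\<^bsub>M\<^esub> \<in> carrier N" using assms(2) by auto
  then have "h \<one>\<^bsub>M\<^esub> = h \<one>\<^bsub>M\<^esub> \<otimes>\<^bsub>N\<^esub> h x" using x(2) by (metis N.r_one)
  also have "\<dots> = h (\<one>\<^bsub>M\<^esub> \<otimes>\<^bsub>M\<^esub> x)"
    by (rule hom_mult[OF assms(1) M.one_closed x(1), symmetric])
  finally show ?thesis using x by simp
qed

lemma hom_eval_word:
  assumes "h \<in> hom M N" "h \<one>\<^bsub>M\<^esub> = \<one>\<^bsub>N\<^esub>" "monoid M" "range f \<subseteq> carrier M"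
  shows "h (eval_word M f u) = eval_word N (\<lambda>x. h (f x)) u"
proof (induction u)
  case (Cons x u)
  have "f x \<in> carrier M" using assms(4) by auto
  then show ?case
    using hom_mult[OF assms(1) _ eval_word_closed[OF assms(3,4)]] Cons by (simp add: eval_word_simps)
qed (simp add: eval_word_simps assms)

section \<open>Preservation of identities under images, isomorphisms and products\<close>

lemma satisfies_image:
  fixes M :: "('a, 'm) monoid_scheme" and N :: "('b, 'k) monoid_scheme" and u v :: "'x list"
  assumes "h \<in> hom M N" "h ` carrier M = carrier N" "monoid M" "monoid N" "satisfies M u v"
  shows "satisfies N u v"
  unfolding satisfies_def
proof (intro allI impI)
  fix f :: "'x \<Rightarrow> 'b" assume "range f \<subseteq> carrier N"
  then have "f x \<in> h ` carrier M" for x unfolding assms(2) by blast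
  then have "\<exists>a. a \<in> carrier M \<and> h a = f x" for x by (metis imageE)
  then obtain g where g: "\<And>x. g x \<in> carrier M \<and> h (g x) = f x" by metis
  then have r: "range g \<subseteq> carrier M" by auto
  note e = hom_eval_word[OF assms(1) hom_one_if_surj[OF assms(1-4)] assms(3) r]
  have f: "(\<lambda>x. h (g x)) = f" using g by auto
  have "eval_word M g u = eval_word M g v" using assms(5) r by (simp add: satisfies_def)
  then show "eval_word N f u = eval_word N f v" using e[of u] e[of v] unfolding f by simp
qed

lemma satisfies_if_iso:
  fixes M :: "('a, 'm) monoid_scheme" and N :: "('b, 'k) monoid_scheme" and u v :: "'x list"
  assumes "monoid M" "monoid N" "M \<cong> N" "satisfies N u v"
  shows "satisfies M u v"
  unfolding satisfies_def
proof (intro allI impI)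
  fix f :: "'x \<Rightarrow> 'a" assume f: "range f \<subseteq> carrier M"
  obtain h where "h \<in> iso M N" using assms(3) by (auto simp: is_iso_def)
  then have h: "h \<in> hom M N" "inj_on h (carrier M)" "h ` carrier M = carrier N"
    by (auto simp: iso_def bij_betw_def)
  note e = hom_eval_word[OF h(1) hom_one_if_surj[OF h(1,3) assms(1,2)] assms(1) f]
  have "range (\<lambda>x. h (f x)) \<subseteq> carrier N" using f h(3) by auto
  then have "h (eval_word M f u) = h (eval_word M f v)"
    using e assms(4) by (simp add: satisfies_def)
  then show "eval_word M f u = eval_word M f v"
    using h(2) eval_word_closed[OF assms(1) f] by (simp add: inj_on_eq_iff)
qed

lemma monoid_product_group:
  assumes "\<And>i. i \<in> I \<Longrightarrow> monoid (F i)"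
  shows "monoid (product_group I F)"
proof (rule monoidI)
  show "x \<otimes>\<^bsub>product_group I F\<^esub> y \<otimes>\<^bsub>product_group I F\<^esub> z =
      x \<otimes>\<^bsub>product_group I F\<^esub> (y \<otimes>\<^bsub>product_group I F\<^esub> z)"
    if "x \<in> carrier (product_group I F)" "y \<in> carrier (product_group I F)" "z \<in> carrier (product_group I F)" for x y z
    using that by (auto simp: product_group_def PiE_iff intro!: restrict_ext monoid.m_assoc assms)
  show "\<one>\<^bsub>product_group I F\<^esub> \<otimes>\<^bsub>product_group I F\<^esub> x = x" if "x \<in> carrier (product_group I F)" for x
    using that assms by (intro ext) (auto simp: product_group_def PiE_iff monoid.l_one extensional_def)
  show "x \<otimes>\<^bsub>product_group I F\<^esub> \<one>\<^bsub>product_group I F\<^esub> = x" if "x \<in> carrier (product_group I F)" for x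
    using that assms by (intro ext) (auto simp: product_group_def PiE_iff monoid.r_one extensional_def)
qed (use assms in \<open>auto simp: product_group_def PiE_iff intro: monoid.m_closed monoid.one_closed\<close>)

lemma eval_word_product:
  "eval_word (product_group I F) f u = (\<lambda>i\<in>I. eval_word (F i) (\<lambda>x. f x i) u)"
  by (induction u) (auto simp: eval_word_simps product_group_def)

lemma satisfies_product:
  fixes F :: "'i \<Rightarrow> ('a, 'm) monoid_scheme" and u v :: "'x list"
  assumes "\<And>i. i \<in> I \<Longrightarrow> satisfies (F i) u v"
  shows "satisfies (product_group I F) u v"
  unfolding satisfies_def
proof (intro allI impI)
  fix f :: "'x \<Rightarrow> 'i \<Rightarrow> 'a" assume "range f \<subseteq> carrier (product_group I F)"
  then have f: "f x i \<in> carrier (F i)" if "i \<in> I" for x i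
    using that by (auto simp: product_group_def)
  have "eval_word (F i) (\<lambda>x. f x i) u = eval_word (F i) (\<lambda>x. f x i) v" if "i \<in> I" for i
  proof -
    have "range (\<lambda>x. f x i) \<subseteq> carrier (F i)" using f[OF that] by blast
    then show ?thesis using assms[OF that] by (simp only: satisfies_def)
  qed
  then show "eval_word (product_group I F) f u = eval_word (product_group I F) f v"
    by (auto simp: eval_word_product intro!: restrict_ext)
qed

text \<open>The easy half of Birkhoff's theorem. A copy of a product is treated as a surjective
  image of it.\<close>

lemma monoid_variety_satisfies: "monoid_variety {M :: 'u monoid. monoid M \<and> satisfies M u v}"
  unfolding monoid_variety_def
proof (intro conjI ballI allI impI)
  fix M N :: "'u monoid" assume M: "M \<in> {M. monoid M \<and> satisfies M u v}" and N: "monoid N \<and> epi M N \<noteq> {}"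
  then obtain h where "h \<in> hom M N" "h ` carrier M = carrier N" by (auto simp: epi_def)
  then have "satisfies N u v" using M N by (intro satisfies_image[of h M N]) simp_all
  then show "N \<in> {M. monoid M \<and> satisfies M u v}" using N by simp
next
  fix M :: "'u monoid" and H assume M: "M \<in> {M. monoid M \<and> satisfies M u v}" and H: "submonoid H M"
  have "eval_word (M\<lparr>carrier := H\<rparr>) f w = eval_word M f w" for f :: "'a \<Rightarrow> 'u" and w
    by (simp add: eval_word_def)
  moreover have "H \<subseteq> carrier M" using H by (rule submonoid.subset)
  ultimately have "satisfies (M\<lparr>carrier := H\<rparr>) u v" using M by (auto simp: satisfies_def)
  then show "M\<lparr>carrier := H\<rparr> \<in> {M. monoid M \<and> satisfies M u v}"
    using M H submonoid.submonoid_is_monoid by blast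
next
  fix I :: "'u set" and F and N :: "'u monoid"
  assume *: "(\<forall>i\<in>I. F i \<in> {M. monoid M \<and> satisfies M u v}) \<and> monoid N \<and> product_group I F \<cong> N"
  then obtain h where "h \<in> hom (product_group I F) N" "h ` carrier (product_group I F) = carrier N"
    by (auto simp: is_iso_def iso_def bij_betw_def)
  moreover have "monoid (product_group I F)" using * by (intro monoid_product_group) simp
  moreover have "satisfies (product_group I F) u v" using * by (intro satisfies_product) simp
  ultimately have "satisfies N u v" using * by (intro satisfies_image[of h "product_group I F" N]) simp_all
  then show "N \<in> {M. monoid M \<and> satisfies M u v}" using * by simp
qed simp

section \<open>Identities in presented monoids\<close>

lemma eval_word_presented:
  assumes R: "R \<subseteq> lists X \<times> lists X" and g: "\<And>x. g x \<in> lists X"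
    and f: "\<And>x. f x = pres_cong X R `` {g x}"
  shows "eval_word (presented_monoid X R) f u = pres_cong X R `` {concat (map g u)}"
proof (induction u)
  case Nil
  then show ?case by (simp add: eval_word_simps presented_monoid_def)
next
  case (Cons x u)
  have "concat (map g u) \<in> lists X" using g by (auto simp: in_lists_conv_set)
  note mult = presented_monoid_mult[OF R g this]
  show ?case unfolding eval_word_simps Cons unfolding f mult by simp
qed

text \<open>Choosing representatives lifts an assignment of congruence classes to one of words, so
  an identity can be tested by substituting words for the variables.\<close>

lemma satisfies_presented_iff:
  assumes R: "R \<subseteq> lists X \<times> lists X"
  shows "satisfies (presented_monoid X R) u v \<longleftrightarrow>
    (\<forall>g. range g \<subseteq> lists X \<longrightarrow> (concat (map g u), concat (map g v)) \<in> pres_cong X R)"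
proof
  have words: "concat (map g w) \<in> lists X" if "range g \<subseteq> lists X" for g :: "'b \<Rightarrow> 'a list" and w
    using that by (auto simp: in_lists_conv_set)
  have car: "carrier (presented_monoid X R) = (\<lambda>w. pres_cong X R `` {w}) ` lists X"
    by (auto simp: presented_monoid_def quotient_def)
  {
    assume sat: "satisfies (presented_monoid X R) u v"
    show "\<forall>g. range g \<subseteq> lists X \<longrightarrow> (concat (map g u), concat (map g v)) \<in> pres_cong X R"
    proof (intro allI impI)
      fix g :: "'b \<Rightarrow> 'a list" assume g: "range g \<subseteq> lists X"
      have "range (\<lambda>x. pres_cong X R `` {g x}) \<subseteq> carrier (presented_monoid X R)"
        unfolding car using g by blast
      then have "eval_word (presented_monoid X R) (\<lambda>x. pres_cong X R `` {g x}) u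
          = eval_word (presented_monoid X R) (\<lambda>x. pres_cong X R `` {g x}) v"
        using sat by (simp only: satisfies_def)
      moreover have "g x \<in> lists X" for x using g by blast
      note eval = eval_word_presented[OF R this HOL.refl]
      ultimately have "pres_cong X R `` {concat (map g u)} = pres_cong X R `` {concat (map g v)}"
        by (simp only: eval)
      then show "(concat (map g u), concat (map g v)) \<in> pres_cong X R"
        by (rule eq_equiv_class[OF _ equiv_pres_cong[OF R] words[OF g]])
    qed
  }
  {
    assume cong: "\<forall>g. range g \<subseteq> lists X \<longrightarrow> (concat (map g u), concat (map g v)) \<in> pres_cong X R"
    show "satisfies (presented_monoid X R) u v"
      unfolding satisfies_def
    proof (intro allI impI)
      fix f :: "'b \<Rightarrow> 'a list set" assume "range f \<subseteq> carrier (presented_monoid X R)"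
      then have "f x \<in> (\<lambda>w. pres_cong X R `` {w}) ` lists X" for x unfolding car by blast
      then have "\<forall>x. \<exists>w. w \<in> lists X \<and> f x = pres_cong X R `` {w}" by (simp add: image_iff Bex_def)
      from choice[OF this] obtain g where "\<forall>x. g x \<in> lists X \<and> f x = pres_cong X R `` {g x}" by (elim exE)
      then have g: "g x \<in> lists X" "f x = pres_cong X R `` {g x}" for x by simp_all
      then have "range g \<subseteq> lists X" by blast
      with cong have "(concat (map g u), concat (map g v)) \<in> pres_cong X R" by simp
      then have "pres_cong X R `` {concat (map g u)} = pres_cong X R `` {concat (map g v)}"
        by (rule equiv_class_eq[OF equiv_pres_cong[OF R]])
      then show "eval_word (presented_monoid X R) f u = eval_word (presented_monoid X R) f v"
        unfolding eval_word_presented[OF R g] .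
    qed
  }
qed

section \<open>Separation\<close>

text \<open>\<open>x\<close> has just as many letters \<open>c\<close> as the prefix demands and
  ends in \<open>c\<close>, so matching the prefix uses up all of \<open>x\<close> and leaves
  \<open>r\<close> to \<open>t\<close>.\<close>

lemma subseq_replicate_prefix:
  assumes "subseq (replicate (count_list x c) c @ r) (x @ t)" "x \<noteq> [] \<longrightarrow> last x = c"
  shows "subseq r t"
  using assms
proof (induction x)
  case (Cons a x)
  show ?case
  proof (cases "a = c")
    case True
    then show ?thesis using Cons by (auto split: if_splits)
  next
    case False
    then have x: "x \<noteq> []" "last x = c" using Cons.prems(2) by (auto split: if_splits)
    then have "c \<in> set x" using last_in_set by blast
    then obtain k where "count_list x c = Suc k" by (metis count_list_0_iff not0_implies_Suc)
    then show ?thesis using Cons x False by auto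
  qed
qed simp

lemma subseq_rev:
  assumes "subseq x y"
  shows "subseq (rev x) (rev y)"
  using assms
proof (induction rule: list_emb.induct)
  case (list_emb_Cons xs ys y)
  then show ?case using subseq_rev_drop_many by simp
next
  case (list_emb_Cons2 x y xs ys)
  then show ?case by (simp add: list_emb_append_mono)
qed simp

lemma subseq_replicate_suffix:
  assumes "subseq (r @ replicate (count_list x c) c) (t @ x)" "x \<noteq> [] \<longrightarrow> hd x = c"
  shows "subseq r t"
proof -
  have "subseq (rev (r @ replicate (count_list x c) c)) (rev (t @ x))"
    by (rule subseq_rev[OF assms(1)])
  then have "subseq (replicate (count_list (rev x) c) c @ rev r) (rev x @ rev t)"
    by (simp add: count_list_rev)
  then have "subseq (rev r) (rev t)"
    by (rule subseq_replicate_prefix) (use assms(2) in \<open>simp add: last_rev\<close>)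
  from subseq_rev[OF this] show ?thesis by simp
qed

text \<open>The type \<open>bool\<close> has two roles: a letter of \<open>w\<close> selects the
  block \<open>AB\<close> or \<open>BA\<close>, whereas in the result \<open>True\<close> is the
  variable \<open>A\<close> and \<open>False\<close> the variable \<open>B\<close>.\<close>

definition identity_word :: "bool list \<Rightarrow> bool \<Rightarrow> bool list" where
  "identity_word w b = concat (map (block [True] [False]) (w @ [b] @ w))"

lemma concat_map_identity_word:
  "concat (map g (identity_word w b)) = concat (map (block (g True) (g False)) (w @ [b] @ w))"
proof -
  have "concat (map g (concat (map (block [True] [False]) bs))) = concat (map (block (g True) (g False)) bs)" for bs
    by (induction bs) (auto simp: block_def)
  then show ?thesis by (simp only: identity_word_def)
qed

text \<open>Every block has each variable once, so the expansion \<open>x\<close> of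
  \<open>w\<close> contains each exactly \<open>length w\<close> times. Its last letter, repeated
  that often, exhausts the first copy of \<open>x\<close>, and its first letter the second copy;
  then \<open>[False, True]\<close> would have to embed in \<open>[True, False]\<close>.\<close>

lemma subseq_separating_identity_words:
  "\<exists>s. length s = 2 * length w + 2 \<and> subseq s (identity_word w False) \<and> \<not> subseq s (identity_word w True)"
proof -
  define x where "x = concat (map (block [True] [False]) w)"
  have count: "count_list x b = length w" for b
    unfolding x_def by (induction w) (auto simp: block_def)
  have sub: "subseq (replicate (length w) b) x" for b
    unfolding x_def by (induction w) (auto simp: block_def)
  have words: "identity_word w False = x @ [False, True] @ x" "identity_word w True = x @ [True, False] @ x"
    by (simp_all add: identity_word_def x_def block_def)
  \<comment> \<open>For empty \<open>w\<close> the values \<open>last x\<close> and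
    \<open>hd x\<close> are unspecified, but they are repeated zero times.\<close>
  define s where "s = replicate (length w) (last x) @ [False, True] @ replicate (length w) (hd x)"
  have "subseq s (identity_word w False)"
    unfolding s_def words by (intro list_emb_append_mono sub subseq_order.refl)
  moreover have "\<not> subseq s (identity_word w True)"
  proof
    assume "subseq s (identity_word w True)"
    then have "subseq (replicate (count_list x (last x)) (last x) @ [False, True] @ replicate (length w) (hd x))
        (x @ [True, False] @ x)"
      unfolding s_def words count .
    then have "subseq ([False, True] @ replicate (length w) (hd x)) ([True, False] @ x)"
      by (rule subseq_replicate_prefix) simp
    then have "subseq ([False, True] @ replicate (count_list x (hd x)) (hd x)) ([True, False] @ x)"
      unfolding count .
    then have "subseq [False, True] [True, False]" by (rule subseq_replicate_suffix) simp
    then show False by simp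
  qed
  ultimately show ?thesis by (intro exI[of _ s]) (simp add: s_def)
qed

section \<open>The identity in the plactic and stylic monoids, and the conclusion\<close>

lemma knuth_rels_lists: "knuth_rels n \<subseteq> lists {1..n} \<times> lists {1..n}"
  by (auto simp: knuth_rels_def)

lemma satisfies_plac:
  assumes "\<And>s. length s = n\<^sup>2 div 4 \<Longrightarrow> \<exists>p q. w = p @ s @ q"
  shows "satisfies (plac n) (identity_word w True) (identity_word w False)"
  unfolding plac_def satisfies_presented_iff[OF knuth_rels_lists] concat_map_identity_word
proof (intro allI impI plactic_identity)
  fix g :: "bool \<Rightarrow> nat list" assume g: "range g \<subseteq> lists {1..n}"
  have "g b \<in> lists {1..n}" for b using g by blast
  then show "set (g True) \<subseteq> {1..n}" "set (g False) \<subseteq> {1..n}" by (auto simp: in_lists_conv_set)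
qed (rule assms)

lemma not_satisfies_styl:
  assumes d: "d = 2 * length w + 2"
  shows "\<not> satisfies (styl d) (identity_word w True) (identity_word w False)"
proof
  assume sat: "satisfies (styl d) (identity_word w True) (identity_word w False)"
  obtain s where s: "length s = d" "subseq s (identity_word w False)" "\<not> subseq s (identity_word w True)"
    using subseq_separating_identity_words[of w] d by blast
  define f where "f b = filter (\<lambda>e. s ! (d - e) = b) [1..<Suc d]" for b
  have R: "knuth_rels d \<union> {([a, a], [a]) | a. a \<in> {1..d}} \<subseteq> lists {1..d} \<times> lists {1..d}"
    using knuth_rels_lists by auto
  have "range f \<subseteq> lists {1..d}" by (auto simp: f_def simp del: upt_Suc)
  then have "(concat (map f (identity_word w True)), concat (map f (identity_word w False)))
      \<in> pres_cong {1..d} (knuth_rels d \<union> {([a, a], [a]) | a. a \<in> {1..d}})"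
    using sat unfolding styl_def satisfies_presented_iff[OF R] by blast
  from dec_runs_styl[OF this]
  have "subseq (rev [1..<Suc d]) (concat (map f (identity_word w True))) \<longleftrightarrow>
      subseq (rev [1..<Suc d]) (concat (map f (identity_word w False)))"
    unfolding dec_runs_def by (simp only: set_eq_iff mem_Collect_eq prod.case split_paired_All)
  then show False
    using s(2,3) by (simp only: subseq_concat_blocks_iff[OF s(1) f_def])
qed

text \<open>Members of \<open>variety_generated\<close> have their carriers in \<open>'u\<close>, so
  the claim is made for every isomorphic copy \<open>S\<close> of \<open>styl d\<close> over
  \<open>'u\<close>.\<close>

theorem corollary4p9:
  fixes n d :: nat and S :: "'u monoid"
  assumes "n \<ge> 1"
    and "d = 2 * (2 ^ (n\<^sup>2 div 4) + n\<^sup>2 div 4)"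
    and "monoid S" and "S \<cong> styl d"
  shows "S \<notin> variety_generated (plac n)"
proof
  assume S: "S \<in> variety_generated (plac n)"
  obtain w :: "bool list" where len: "length w = 2 ^ (n\<^sup>2 div 4) + n\<^sup>2 div 4 - 1"
    and w: "\<And>s. length s = n\<^sup>2 div 4 \<Longrightarrow> \<exists>p q. w = p @ s @ q"
    using de_bruijn_word_exists[of "n\<^sup>2 div 4"] by blast
  \<comment> \<open>A power of 2 is positive, so the truncated subtraction in the length of
    \<open>w\<close> is exact.\<close>
  have "2 * (a + b) = 2 * (a + b - 1) + 2" if "0 < a" for a b :: nat using that by simp
  from this[of "2 ^ (n\<^sup>2 div 4)" "n\<^sup>2 div 4"] have d: "d = 2 * length w + 2" unfolding len assms(2) by simp
  let ?K = "{M :: 'u monoid. monoid M \<and> satisfies M (identity_word w True) (identity_word w False)}"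
  have "P \<in> ?K" if "monoid P" "P \<cong> plac n" for P
    using satisfies_if_iso[OF that(1) monoid_plac that(2) satisfies_plac[OF w]] that(1) by simp
  then have "S \<in> ?K"
    using S monoid_variety_satisfies unfolding variety_generated_def by blast
  then have sat: "satisfies S (identity_word w True) (identity_word w False)" by simp
  obtain h where "h \<in> hom S (styl d)" "h ` carrier S = carrier (styl d)"
    using assms(4) by (auto simp: is_iso_def iso_def bij_betw_def)
  from satisfies_image[OF this assms(3) monoid_styl sat] show False
    using not_satisfies_styl[OF d] by simp
qed

end
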